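(* Let $n\ge 1$ be an integer and let $Q$ be the transition matrix on $\{0,1,\dots,n\}$ of the Burnside process on $\{0,1\}^n$ under $S_n$, lumped to orbits. The non-zero eigenvalues of $Q$ are $1$ and $$\frac{\binom{2k}{k}^2}{2^{4k}},\qquad 1\le k\le \lfloor n/2\rfloor .$$ Moreover, the eigenfunctions corresponding to the zero eigenvalues are the discrete Chebyshev polynomials on $\{0,1,\dots,n\}$ of odd degree, and, for $1\le k\le \frac n2$, the eigenfunction corresponding to the eigenvalue $\frac{\binom{2k}{k}^2}{2^{4k}}$ is the discrete Chebyshev polynomial on $\{0,1,\dots,n\}$ of degree $2k$.
   Context: Let $\mathcal{X}=C_2^n=\{0,1\}^n$ with $G=S_n$ acting by permuting coordinates. Put $\mathcal{X}_g=\{y\in\mathcal{X}:y^g=y\}$ and $G_x=\{g\in G:x^g=x\}$. The Burnside process is the Markov chain $X_0,X_1,\dots$ on $\mathcal{X}$ that, from $x$, chooses $g\in G_x$ uniformly at random and then chooses $y\in\mathcal{X}_g$ uniformly at random and moves to $y$; its transition matrix is $K(x,y)=\sum_{g\in G_x\cap G_y}\frac{1}{|G_x|}\frac{1}{|\mathcal{X}_g|}$. Let $|x|$ denote the number of ones in $x$; the orbits of $S_n$ are the sets $\{x:|x|=j\}$, $0\le j\le n$. The sequence $|X_0|,|X_1|,\dots$ is a Markov chain on $\{0,1,\dots,n\}$, and $Q$ is its transition matrix: $Q(i,j)=\sum_{y:|y|=j}K(x,y)$ for any $x$ with $|x|=i$. The matrix $Q$ is symmetric with uniform stationary distribution $u(j)=\frac1{n+1}$.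 It acts on functions by $Qf(i)=\sum_{j}Q(i,j)f(j)$, and an eigenfunction $f$ with eigenvalue $\beta$ satisfies $Qf=\beta f$. The discrete Chebyshev polynomials $T_j^n$, $0\le j\le n$, on $\{0,\dots,n\}$ are the orthogonal polynomials for the uniform distribution on $\{0,\dots,n\}$, with $T^n_j$ of degree $j$; normalized by $T_j^n(0)=1$ they are $$T_j^n(x)=\sum_{l=0}^{j}\frac{(-j)_l(j+1)_l(-x)_l}{(l!)^2(-n)_l},$$ where $(a)_l=a(a+1)\cdots(a+l-1)$, $(a)_0=1$. *)

theory Defs
  imports
    "HOL-Combinatorics.Permutations"
    "HOL-Library.FuncSet"
    "Jordan_Normal_Form.Char_Poly"
    "Jordan_Normal_Form.VS_Connect"
begin

definition words :: "nat \<Rightarrow> (nat \<Rightarrow> nat) set" where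
  "words n = {..<n} \<rightarrow>\<^sub>E {0, 1}"

text \<open>
  A permutation \<open>g\<close> of \<open>{..<n}\<close> acts on the right by \<open>x\<^sup>g = x \<circ> g\<close>; since \<open>g\<close> fixes every
  index outside \<open>{..<n}\<close>, this preserves extensionality, so it is an action on \<^term>\<open>words n\<close>.
\<close>

definition fixed_words :: "nat \<Rightarrow> (nat \<Rightarrow> nat) \<Rightarrow> (nat \<Rightarrow> nat) set" where
  "fixed_words n g = {y \<in> words n. y \<circ> g = y}"

definition stabilizer :: "nat \<Rightarrow> (nat \<Rightarrow> nat) \<Rightarrow> (nat \<Rightarrow> nat) set" where
  "stabilizer n x = {g. g permutes {..<n} \<and> x \<circ> g = x}"

definition burnside_kernel :: "nat \<Rightarrow> (nat \<Rightarrow> nat) \<Rightarrow> (nat \<Rightarrow> nat) \<Rightarrow> real" where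
  "burnside_kernel n x y =
     (\<Sum>g \<in> stabilizer n x \<inter> stabilizer n y.
        1 / real (card (stabilizer n x)) * (1 / real (card (fixed_words n g))))"

definition weight :: "nat \<Rightarrow> (nat \<Rightarrow> nat) \<Rightarrow> nat" where
  "weight n x = card {i. i < n \<and> x i = 1}"

text \<open>
  The choice of the representative \<open>x\<close> of the orbit of weight \<open>i\<close> is immaterial, see
  \<open>burnside_lumped_eq\<close> below.
\<close>

definition burnside_lumped :: "nat \<Rightarrow> real mat" where
  "burnside_lumped n = mat (n + 1) (n + 1) (\<lambda>(i, j).
     \<Sum>y \<in> {y \<in> words n. weight n y = j}.
       burnside_kernel n (SOME x. x \<in> words n \<and> weight n x = i) y)"

lemma words_comp:
  assumes "g permutes {..<n}" and "x \<in> words n"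
  shows "x \<circ> g \<in> words n"
  using assms unfolding words_def
  by (auto simp: PiE_iff extensional_def permutes_in_image[OF assms(1)] permutes_not_in
      simp del: lessThan_iff)

lemma weight_comp:
  assumes g: "g permutes {..<n}"
  shows "weight n (x \<circ> g) = weight n x"
proof -
  have "bij_betw g {i. i < n \<and> (x \<circ> g) i = 1} {i. i < n \<and> x i = 1}"
  proof (rule bij_betwI')
    fix i j
    show "(g i = g j) = (i = j)" using permutes_inj[OF g] by (simp add: inj_eq)
  next
    fix i assume "i \<in> {i. i < n \<and> (x \<circ> g) i = 1}"
    then show "g i \<in> {i. i < n \<and> x i = 1}"
      using permutes_in_image[OF g, of i] by simp
  next
    fix j assume j: "j \<in> {i. i < n \<and> x i = 1}"
    have "g (inv_into UNIV g j) = j" by (rule permutes_inverses(1)[OF g])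
    moreover have "inv_into UNIV g j < n"
      using permutes_in_image[OF permutes_inv[OF g], of j] j by simp
    ultimately show "\<exists>i\<in>{i. i < n \<and> (x \<circ> g) i = 1}. j = g i" using j by force
  qed
  then show ?thesis unfolding weight_def by (rule bij_betw_same_card)
qed

lemma ex_word_of_weight:
  assumes "i \<le> n"
  shows "\<exists>x. x \<in> words n \<and> weight n x = i"
proof -
  let ?x = "\<lambda>k\<in>{..<n}. if k < i then 1 else (0::nat)"
  have "{k. k < n \<and> ?x k = 1} = {..<i}" using assms by auto
  then have "weight n ?x = i" by (simp add: weight_def)
  moreover have "?x \<in> words n" by (auto simp: words_def)
  ultimately show ?thesis by blast
qed

lemma same_weight_same_orbit:
  assumes x: "x \<in> words n" and y: "y \<in> words n" and w: "weight n x = weight n y"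
  shows "\<exists>g. g permutes {..<n} \<and> y = x \<circ> g"
proof -
  let ?A = "\<lambda>x. {i. i < n \<and> x i = 1}" and ?B = "\<lambda>x. {..<n} - {i. i < n \<and> x i = (1::nat)}"
  have "card (?A y) = card (?A x)" using w by (simp add: weight_def)
  then obtain a where a: "bij_betw a (?A y) (?A x)"
    using finite_same_card_bij[of "?A y" "?A x"] by auto
  have "card (?B y) = card (?B x)"
    using w by (subst (1 2) card_Diff_subset) (auto simp: weight_def)
  then obtain b where b: "bij_betw b (?B y) (?B x)"
    using finite_same_card_bij[of "?B y" "?B x"] by auto
  define g where "g = (\<lambda>i. if i < n then if y i = 1 then a i else b i else i)"
  have "bij_betw g (?A y) (?A x)"
    using a by (rule bij_betw_cong[THEN iffD1, rotated]) (auto simp: g_def)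
  moreover have "bij_betw g (?B y) (?B x)"
    using b by (rule bij_betw_cong[THEN iffD1, rotated]) (auto simp: g_def)
  ultimately have "bij_betw g (?A y \<union> ?B y) (?A x \<union> ?B x)"
    by (rule bij_betw_combine) auto
  moreover have "?A z \<union> ?B z = {..<n}" for z by auto
  ultimately have "bij_betw g {..<n} {..<n}" by simp
  then have g: "g permutes {..<n}" by (rule bij_imp_permutes) (simp add: g_def)
  have "y i = x (g i)" for i
  proof (cases "i < n")
    case True
    have *: "x k = 0 \<or> x k = 1" "y k = 0 \<or> y k = 1" if "k < n" for k
      using x y that by (auto simp: words_def PiE_iff)
    show ?thesis
    proof (cases "y i = 1")
      case T: True
      then have "a i \<in> ?A x" using bij_betwE[OF a] True by blast
      then show ?thesis using T True by (simp add: g_def)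
    next
      case F: False
      then have "b i \<in> ?B x" using bij_betwE[OF b] True by blast
      then show ?thesis using F True * [of "b i"] * [of i] by (auto simp: g_def)
    qed
  next
    case False
    then show ?thesis using x y by (simp add: g_def words_def PiE_iff extensional_def)
  qed
  then show ?thesis using g by (intro exI[of _ g]) (simp add: fun_eq_iff)
qed

lemma stabilizer_comp:
  assumes g: "g permutes {..<n}"
  shows "stabilizer n (x \<circ> g) = (\<lambda>h. inv_into UNIV g \<circ> h \<circ> g) ` stabilizer n x"
proof -
  have *: "g (inv_into UNIV g k) = k" "inv_into UNIV g (g k) = k" for k
    using permutes_inverses[OF g] by auto
  show ?thesis
  proof (intro equalityI subsetI)
    fix h assume h: "h \<in> stabilizer n (x \<circ> g)"
    then have hp: "h permutes {..<n}" and hx: "\<And>k. x (g (h k)) = x (g k)"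
      by (auto simp: stabilizer_def fun_eq_iff)
    have "g \<circ> h \<circ> inv_into UNIV g \<in> stabilizer n x"
      using hp hx * by (auto simp: stabilizer_def fun_eq_iff intro!: permutes_compose g permutes_inv)
    moreover have "h = inv_into UNIV g \<circ> (g \<circ> h \<circ> inv_into UNIV g) \<circ> g" using * by (simp add: fun_eq_iff)
    ultimately show "h \<in> (\<lambda>h. inv_into UNIV g \<circ> h \<circ> g) ` stabilizer n x" by blast
  next
    fix h assume "h \<in> (\<lambda>h. inv_into UNIV g \<circ> h \<circ> g) ` stabilizer n x"
    then obtain h' where h: "h = inv_into UNIV g \<circ> h' \<circ> g" and "h' \<in> stabilizer n x" by blast
    then have "h' permutes {..<n}" and "\<And>k. x (h' k) = x k"
      by (auto simp: stabilizer_def fun_eq_iff)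
    then show "h \<in> stabilizer n (x \<circ> g)"
      using * unfolding h by (auto simp: stabilizer_def fun_eq_iff intro!: permutes_compose g permutes_inv)
  qed
qed

lemma inj_conj:
  assumes g: "g permutes {..<n}"
  shows "inj (\<lambda>h. inv_into UNIV g \<circ> h \<circ> g)"
proof (rule injI)
  fix h h' assume "inv_into UNIV g \<circ> h \<circ> g = inv_into UNIV g \<circ> h' \<circ> g"
  then have "g (inv_into UNIV g (h (g (inv_into UNIV g k)))) = g (inv_into UNIV g (h' (g (inv_into UNIV g k))))" for k
    by (simp add: fun_eq_iff)
  then show "h = h'" by (simp add: permutes_inverses[OF g] fun_eq_iff)
qed

lemma inj_comp:
  fixes g :: "nat \<Rightarrow> nat"
  assumes g: "g permutes {..<n}"
  shows "inj (\<lambda>x :: nat \<Rightarrow> 'b. x \<circ> g)"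
proof (rule injI)
  fix x y :: "nat \<Rightarrow> 'b" assume "x \<circ> g = y \<circ> g"
  then have "x (g (inv_into UNIV g k)) = y (g (inv_into UNIV g k))" for k by (simp add: fun_eq_iff)
  then show "x = y" by (simp add: permutes_inverses[OF g] fun_eq_iff)
qed

lemma card_fixed_words_conj:
  assumes g: "g permutes {..<n}"
  shows "card (fixed_words n (inv_into UNIV g \<circ> h \<circ> g)) = card (fixed_words n h)"
proof -
  have *: "g (inv_into UNIV g k) = k" "inv_into UNIV g (g k) = k" for k
    using permutes_inverses[OF g] by auto
  have "fixed_words n (inv_into UNIV g \<circ> h \<circ> g) = (\<lambda>x. x \<circ> g) ` fixed_words n h"
  proof (intro equalityI subsetI)
    fix y assume y: "y \<in> fixed_words n (inv_into UNIV g \<circ> h \<circ> g)"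
    then have yw: "y \<in> words n" and yh: "\<And>k. y (inv_into UNIV g (h (g k))) = y k"
      by (auto simp: fixed_words_def fun_eq_iff)
    have "y (inv_into UNIV g (h k)) = y (inv_into UNIV g k)" for k using yh[of "inv_into UNIV g k"] * by simp
    then have "y \<circ> inv_into UNIV g \<in> fixed_words n h"
      using words_comp[OF permutes_inv[OF g] yw] by (simp add: fixed_words_def fun_eq_iff)
    moreover have "y = (y \<circ> inv_into UNIV g) \<circ> g" using * by (simp add: fun_eq_iff)
    ultimately show "y \<in> (\<lambda>x. x \<circ> g) ` fixed_words n h" by blast
  next
    fix y assume "y \<in> (\<lambda>x. x \<circ> g) ` fixed_words n h"
    then show "y \<in> fixed_words n (inv_into UNIV g \<circ> h \<circ> g)"
      using words_comp[OF g] * by (auto simp: fixed_words_def fun_eq_iff)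
  qed
  then show ?thesis using inj_comp[OF g] by (metis card_image inj_on_subset subset_UNIV)
qed

lemma burnside_kernel_comp:
  assumes g: "g permutes {..<n}"
  shows "burnside_kernel n (x \<circ> g) (y \<circ> g) = burnside_kernel n x y"
proof -
  have "card (stabilizer n (x \<circ> g)) = card (stabilizer n x)"
    unfolding stabilizer_comp[OF g] by (rule card_image) (rule inj_on_subset[OF inj_conj[OF g]], simp)
  moreover have "stabilizer n (x \<circ> g) \<inter> stabilizer n (y \<circ> g)
      = (\<lambda>h. inv_into UNIV g \<circ> h \<circ> g) ` (stabilizer n x \<inter> stabilizer n y)"
    unfolding stabilizer_comp[OF g] by (rule image_Int[symmetric]) (rule inj_conj[OF g])
  moreover have "inj_on (\<lambda>h. inv_into UNIV g \<circ> h \<circ> g) (stabilizer n x \<inter> stabilizer n y)"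
    by (rule inj_on_subset[OF inj_conj[OF g]]) simp
  ultimately show ?thesis
    unfolding burnside_kernel_def by (simp add: sum.reindex card_fixed_words_conj[OF g])
qed

lemma burnside_lumped_eq:
  assumes x: "x \<in> words n" and i: "weight n x = i" and "i \<le> n" "j \<le> n"
  shows "burnside_lumped n $$ (i, j) =
    (\<Sum>y \<in> {y \<in> words n. weight n y = j}. burnside_kernel n x y)"
proof -
  define x0 where "x0 = (SOME x. x \<in> words n \<and> weight n x = i)"
  have x0: "x0 \<in> words n" "weight n x0 = i"
    using someI_ex[OF ex_word_of_weight[OF \<open>i \<le> n\<close>]] unfolding x0_def by auto
  then obtain g where g: "g permutes {..<n}" and xg: "x = x0 \<circ> g"
    using same_weight_same_orbit[OF x0(1) x] i by auto
  let ?W = "{y \<in> words n. weight n y = j}"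
  have *: "g (inv_into UNIV g k) = k" "inv_into UNIV g (g k) = k" for k
    using permutes_inverses[OF g] by auto
  have W: "(\<lambda>y. y \<circ> g) ` ?W = ?W"
  proof (intro equalityI subsetI)
    fix y assume "y \<in> (\<lambda>y. y \<circ> g) ` ?W"
    then show "y \<in> ?W" using words_comp[OF g] weight_comp[OF g] by auto
  next
    fix y assume y: "y \<in> ?W"
    then have "y \<circ> inv_into UNIV g \<in> ?W"
      using words_comp[OF permutes_inv[OF g]] weight_comp[OF permutes_inv[OF g]] by auto
    moreover have "y = (y \<circ> inv_into UNIV g) \<circ> g" using * by (simp add: fun_eq_iff)
    ultimately show "y \<in> (\<lambda>y. y \<circ> g) ` ?W" by blast
  qed
  have "(\<Sum>y\<in>?W. burnside_kernel n x y) = (\<Sum>y\<in>(\<lambda>y. y \<circ> g) ` ?W. burnside_kernel n x y)"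
    by (simp only: W)
  also have "\<dots> = (\<Sum>y\<in>?W. burnside_kernel n x0 y)"
    by (subst sum.reindex)
      (auto simp: xg burnside_kernel_comp[OF g] intro: inj_on_subset[OF inj_comp[OF g]])
  finally show ?thesis using assms by (simp add: burnside_lumped_def x0_def)
qed

definition discrete_chebyshev :: "nat \<Rightarrow> nat \<Rightarrow> real \<Rightarrow> real" where
  "discrete_chebyshev n j x =
     (\<Sum>l = 0..j. pochhammer (- real j) l * pochhammer (real j + 1) l * pochhammer (- x) l
        / ((fact l)\<^sup>2 * pochhammer (- real n) l))"

text \<open>A function \<open>f\<close> on \<open>{0, \<dots>, n}\<close> is represented by the vector with entries \<open>f 0, \<dots>, f n\<close>.\<close>

definition discrete_chebyshev_vec :: "nat \<Rightarrow> nat \<Rightarrow> real vec" where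
  "discrete_chebyshev_vec n j = vec (n + 1) (\<lambda>i. discrete_chebyshev n j (real i))"

definition eigenspace :: "real mat \<Rightarrow> real \<Rightarrow> real vec set" where
  "eigenspace A \<beta> = {v \<in> carrier_vec (dim_row A). A *\<^sub>v v = \<beta> \<cdot>\<^sub>v v}"

definition eigenbasis :: "real mat \<Rightarrow> real \<Rightarrow> 'i set \<Rightarrow> ('i \<Rightarrow> real vec) \<Rightarrow> bool" where
  "eigenbasis A \<beta> I v \<longleftrightarrow>
     (\<forall>i\<in>I. eigenvector A (v i) \<beta>) \<and> inj_on v I \<and>
     \<not> LinearCombinations.module.lin_dep class_ring (module_vec TYPE(real) (dim_row A)) (v ` I) \<and>
     LinearCombinations.module.span class_ring (module_vec TYPE(real) (dim_row A)) (v ` I)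
       = eigenspace A \<beta>"

end

theory Submission
  imports Defs "HOL-Computational_Algebra.Formal_Power_Series"
begin

text \<open>
  Choosing a uniform permutation of \<open>m\<close> points and then a bit for each of its cycles produces
  \<open>a\<close> ones with probability \<open>\<alpha>\<^sub>a \<alpha>\<^sub>m\<^sub>-\<^sub>a\<close>, where \<open>\<alpha>\<^sub>m = binom(2m, m) / 4\<^sup>m = (1/2)\<^sub>m / m!\<close> (the discrete
  arcsine law, \<open>arcsine_weight\<close> below). A word of weight \<open>i\<close> has stabilizer \<open>S\<^sub>i \<times> S\<^sub>n\<^sub>-\<^sub>i\<close>, so from \<open>i\<close> the lumped
  chain moves to the sum of two independent arcsine variables on \<open>i\<close> and on \<open>n - i\<close> points
  (\<open>burnside_lumped_apply\<close>). Two properties of \<open>Q\<close> can be read off.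

  First, \<open>Q\<close> is symmetric (\<open>burnside_lumped_sym\<close>). Second, it does not raise the degree of a
  polynomial: the binomial moments of the arcsine law are \<open>\<alpha>\<^sub>r binom(m, r)\<close>, whence by Vandermonde's
  identity \<open>Q\<close> sends \<open>x \<mapsto> binom(x, d)\<close> to
  \<open>x \<mapsto> \<Sum>\<^sub>r \<alpha>\<^sub>r \<alpha>\<^sub>d\<^sub>-\<^sub>r binom(x, r) binom(n - x, d - r)\<close>, whose leading coefficient is
  \<open>\<beta>\<^sub>d / d!\<close> with \<open>\<beta>\<^sub>d = \<Sum>\<^sub>r (-1)\<^sup>d\<^sup>-\<^sup>r binom(d, r) \<alpha>\<^sub>r \<alpha>\<^sub>d\<^sub>-\<^sub>r\<close>.

  Let \<open>T\<^sub>d\<close> have degree \<open>d\<close> and be orthogonal to all polynomials of degree below \<open>d\<close>. Then \<open>Q T\<^sub>d - \<beta>\<^sub>d T\<^sub>d\<close> has degree below \<open>d\<close>, and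
  by symmetry it is also orthogonal to every polynomial of degree below \<open>d\<close>, in particular to
  itself; so it vanishes on \<open>{0, \<dots>, n}\<close> (\<open>lumped_apply_chebyshev\<close>). This orthogonality of the
  discrete Chebyshev polynomials is \<open>chebyshev_orthogonal\<close>: against \<open>binom(n - x, m)\<close> the
  hypergeometric sum collapses to a \<open>d\<close>-th finite difference of a polynomial of degree \<open>d - 1\<close>.

  For the numbers \<open>\<beta>\<^sub>d\<close>, the exponential generating function \<open>F(x) = \<Sum>\<^sub>r \<alpha>\<^sub>r x\<^sup>r / r!\<close> equals
  \<open>e\<^sup>x\<^sup>/\<^sup>2 g(x)\<close> with \<open>g(x) = I\<^sub>0(x/2)\<close> even, so \<open>\<Sum>\<^sub>d \<beta>\<^sub>d x\<^sup>d / d! = F(x) F(-x) = g(x)\<^sup>2\<close>. The odd coefficients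
  vanish, and the even ones give \<open>\<beta>\<^sub>2\<^sub>k = \<alpha>\<^sub>k\<^sup>2\<close>. These squares are distinct and non-zero. The \<open>n + 1\<close>
  vectors of the \<open>T\<^sub>j\<close> are orthogonal and span everything, so each eigenspace is spanned by the
  \<open>T\<^sub>j\<close> that have its eigenvalue (\<open>eigenbasis_chebyshev\<close>).
\<close>

section \<open>Colourings invariant under a permutation that preserves a labelling\<close>

lemma card_invariant_colourings_fixed_point:
  assumes "a \<notin> S" "q permutes S"
  shows "card {y \<in> insert a S \<rightarrow>\<^sub>E D. y \<circ> q = y} = card D * card {y \<in> S \<rightarrow>\<^sub>E D. y \<circ> q = y}"
proof -
  have qa: "q k = a \<longleftrightarrow> k = a" for k
    using assms by (metis permutes_def)
  have inv: "(y(a := d)) \<circ> q = y(a := d) \<longleftrightarrow> (\<forall>k. k \<noteq> a \<longrightarrow> y (q k) = y k)" for y :: "'a \<Rightarrow> 'b" and d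
    by (auto simp: fun_eq_iff qa)
  have q: "q a = a" using qa[of a] by simp
  have "bij_betw (\<lambda>(d, y). y(a := d)) (D \<times> {y \<in> S \<rightarrow>\<^sub>E D. y \<circ> q = y})
          {y \<in> insert a S \<rightarrow>\<^sub>E D. y \<circ> q = y}"
  proof (rule bij_betw_byWitness[where f' = "\<lambda>z. (z a, z(a := undefined))"])
    show "\<forall>p\<in>D \<times> {y \<in> S \<rightarrow>\<^sub>E D. y \<circ> q = y}.
       (\<lambda>z. (z a, z(a := undefined))) ((\<lambda>(d, y). y(a := d)) p) = p"
      using assms(1) by (auto simp: PiE_iff extensional_def)
    show "(\<lambda>(d, y). y(a := d)) ` (D \<times> {y \<in> S \<rightarrow>\<^sub>E D. y \<circ> q = y}) \<subseteq> {y \<in> insert a S \<rightarrow>\<^sub>E D. y \<circ> q = y}"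
      by (auto simp: inv simp del: fun_upd_apply) (auto simp: PiE_iff extensional_def fun_eq_iff split: if_splits)
    have "(z(a := undefined)) \<in> S \<rightarrow>\<^sub>E D" "(z(a := undefined)) \<circ> q = z(a := undefined)"
      if "z \<in> insert a S \<rightarrow>\<^sub>E D" "z \<circ> q = z" for z
      using that assms(1) unfolding inv by (auto simp: PiE_iff extensional_def fun_eq_iff)
    then show "(\<lambda>z. (z a, z(a := undefined))) ` {y \<in> insert a S \<rightarrow>\<^sub>E D. y \<circ> q = y}
       \<subseteq> D \<times> {y \<in> S \<rightarrow>\<^sub>E D. y \<circ> q = y}" by blast
  qed auto
  from bij_betw_same_card[OF this] show ?thesis by (simp add: card_cartesian_product)
qed

text \<open>
  Every permutation of \<open>insert a S\<close> is \<open>transpose a b \<circ> q\<close> with \<open>q\<close> a permutation of \<open>S\<close>. For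
  \<open>b = a\<close> the point \<open>a\<close> is a new cycle, whose colour is free. For \<open>b \<in> S\<close>, the case treated
  here, \<open>a\<close> is inserted into the cycle of \<open>b\<close> and takes its colour.
\<close>

lemma card_invariant_colourings_insert_in_cycle:
  assumes "a \<notin> S" "b \<in> S" "q permutes S"
  shows "card {y \<in> insert a S \<rightarrow>\<^sub>E D. y \<circ> (transpose a b \<circ> q) = y}
       = card {y \<in> S \<rightarrow>\<^sub>E D. y \<circ> q = y}"
proof -
  have ab: "a \<noteq> b" using assms by auto
  have qa: "q k = a \<longleftrightarrow> k = a" for k
    using assms(1,3) by (metis permutes_def)
  have q: "q a = a" using qa[of a] by simp
  have "bij_betw (\<lambda>y. y(a := y b)) {y \<in> S \<rightarrow>\<^sub>E D. y \<circ> q = y}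
          {y \<in> insert a S \<rightarrow>\<^sub>E D. y \<circ> (transpose a b \<circ> q) = y}"
  proof (rule bij_betw_byWitness[where f' = "\<lambda>z. z(a := undefined)"])
    show "\<forall>y\<in>{y \<in> S \<rightarrow>\<^sub>E D. y \<circ> q = y}. (\<lambda>z. z(a := undefined)) (y(a := y b)) = y"
      using assms(1) by (auto simp: PiE_iff extensional_def)
    have za: "z b = z a" if "z \<circ> (transpose a b \<circ> q) = z" for z :: "'a \<Rightarrow> 'b"
      using fun_cong[OF that, of a] q by simp
    then show "\<forall>z\<in>{y \<in> insert a S \<rightarrow>\<^sub>E D. y \<circ> (transpose a b \<circ> q) = y}.
         (z(a := undefined))(a := (z(a := undefined)) b) = z"
      using ab by (auto simp: fun_eq_iff)
    show "(\<lambda>y. y(a := y b)) ` {y \<in> S \<rightarrow>\<^sub>E D. y \<circ> q = y}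
      \<subseteq> {y \<in> insert a S \<rightarrow>\<^sub>E D. y \<circ> (transpose a b \<circ> q) = y}"
    proof (clarify, intro conjI)
      fix y assume y: "y \<in> S \<rightarrow>\<^sub>E D" "y \<circ> q = y"
      show "y(a := y b) \<in> insert a S \<rightarrow>\<^sub>E D" using y assms by (auto simp: PiE_iff extensional_def)
      have "y (q k) = y k" for k using fun_cong[OF y(2), of k] by simp
      then show "y(a := y b) \<circ> (transpose a b \<circ> q) = y(a := y b)"
        using ab qa by (auto simp: fun_eq_iff transpose_def)
    qed
    show "(\<lambda>z. z(a := undefined)) ` {y \<in> insert a S \<rightarrow>\<^sub>E D. y \<circ> (transpose a b \<circ> q) = y}
      \<subseteq> {y \<in> S \<rightarrow>\<^sub>E D. y \<circ> q = y}"
    proof (clarify, intro conjI)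
      fix z assume z: "z \<in> insert a S \<rightarrow>\<^sub>E D" "z \<circ> (transpose a b \<circ> q) = z"
      show "z(a := undefined) \<in> S \<rightarrow>\<^sub>E D" using z assms by (auto simp: PiE_iff extensional_def)
      have "z (transpose a b (q k)) = z k" for k using fun_cong[OF z(2), of k] by simp
      then show "z(a := undefined) \<circ> q = z(a := undefined)"
        using ab qa za[OF z(2)] by (auto simp: fun_eq_iff transpose_def) (metis)+
    qed
  qed
  from bij_betw_same_card[OF this] show ?thesis by simp
qed

lemma label_invariant_insert:
  assumes "a \<notin> S" "b \<in> insert a S" "q permutes S"
  shows "(\<forall>k\<in>insert a S. c ((transpose a b \<circ> q) k) = c k) \<longleftrightarrow> c b = c a \<and> (\<forall>k\<in>S. c (q k) = c k)"
proof (cases "b = a")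
  case True
  have "q a = a" using assms(1,3) by (auto simp: permutes_def)
  with True show ?thesis by auto
next
  case False
  have qa: "q a = a" using assms(1,3) by (auto simp: permutes_def)
  have "c (transpose a b (q k)) = c (q k)" if "c b = c a" for k
    using that by (auto simp: transpose_def)
  then show ?thesis using qa by auto
qed

text \<open>
  An invariant colouring is a choice of a colour for each cycle, so the summand is
  \<open>\<theta>\<close> to the number of cycles of \<open>g\<close>, with \<open>\<theta> = 1 / card D\<close>. Without labels this is the
  normalization \<open>\<theta> (\<theta> + 1) \<dots> (\<theta> + m - 1)\<close> of Ewens' distribution; the labels split \<open>S\<close> into blocks
  that \<open>g\<close> preserves. In the inductive step a new point \<open>a\<close> contributes \<open>\<theta>\<close> as a cycle of its own
  and \<open>1\<close> for each point of its block after which it can be inserted. One colour counts the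
  permutations themselves, two colours give the Burnside kernel.
\<close>

lemma sum_inverse_card_invariant_colourings:
  fixes c :: "'a \<Rightarrow> 'v" and D :: "'d set"
  assumes "finite S" "finite V" "c ` S \<subseteq> V"
  shows "(\<Sum>g | g permutes S \<and> (\<forall>k\<in>S. c (g k) = c k). 1 / real (card {y \<in> S \<rightarrow>\<^sub>E D. y \<circ> g = y}))
       = (\<Prod>v\<in>V. pochhammer (1 / real (card D)) (card {k \<in> S. c k = v}))"
  using assms(1,3)
proof (induction S)
  case empty
  have "{g. g = (id :: 'a \<Rightarrow> 'a)} = {id}" by auto
  then show ?case by simp
next
  case (insert a S)
  define W where "W = (\<lambda>S (g :: 'a \<Rightarrow> 'a). 1 / real (card {y. (y :: 'a \<Rightarrow> 'd) \<in> S \<rightarrow>\<^sub>E D \<and> y \<circ> g = y}))"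
  define G where "G = (\<lambda>S. {g. g permutes S \<and> (\<forall>k\<in>S. c (g k) = c k)})"
  let ?d = "1 / real (card D)"
  have fin: "finite {g. g permutes T}" if "finite T" for T :: "'a set"
    using that by (rule finite_permutations)
  have sumG: "sum f (G T) = (\<Sum>g | g permutes T. if (\<forall>k\<in>T. c (g k) = c k) then f g else 0)"
    if "finite T" for T and f :: "('a \<Rightarrow> 'a) \<Rightarrow> real"
    unfolding G_def using fin[OF that] by (simp add: sum.inter_filter[symmetric])
  have step: "(\<Sum>q | q permutes S. if (\<forall>k\<in>insert a S. c ((transpose a b \<circ> q) k) = c k)
          then W (insert a S) (transpose a b \<circ> q) else 0)
      = (if c b = c a then (if b = a then ?d else 1) * sum (W S) (G S) else 0)"
    if b: "b \<in> insert a S" for b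
  proof -
    have W: "W (insert a S) (transpose a b \<circ> q) = (if b = a then ?d else 1) * W S q"
      if "q permutes S" for q
    proof (cases "b = a")
      case True
      then show ?thesis unfolding W_def
        using card_invariant_colourings_fixed_point[OF insert.hyps(2) that, of D] by simp
    next
      case False
      then have "b \<in> S" using b by auto
      with False show ?thesis unfolding W_def
        using card_invariant_colourings_insert_in_cycle[OF insert.hyps(2) _ that] by simp
    qed
    have "(\<Sum>q | q permutes S. if (\<forall>k\<in>insert a S. c ((transpose a b \<circ> q) k) = c k)
          then W (insert a S) (transpose a b \<circ> q) else 0)
       = (\<Sum>q | q permutes S. if c b = c a \<and> (\<forall>k\<in>S. c (q k) = c k)
           then (if b = a then ?d else 1) * W S q else 0)"
      by (rule sum.cong[OF refl], rule if_cong)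
        (use label_invariant_insert[OF insert.hyps(2) b] W in auto)
    also have "\<dots> = (if c b = c a then (if b = a then ?d else 1) * sum (W S) (G S) else 0)"
      by (auto simp: sumG[OF insert.hyps(1)] sum_distrib_left intro!: sum.cong)
    finally show ?thesis .
  qed
  let ?m = "\<lambda>S v. card {k \<in> S. c k = v}"
  have "sum (W (insert a S)) (G (insert a S)) = (\<Sum>g | g permutes insert a S.
      if (\<forall>k\<in>insert a S. c (g k) = c k) then W (insert a S) g else 0)"
    using insert.hyps by (intro sumG) simp
  also have "\<dots> = (\<Sum>b\<in>insert a S. \<Sum>q | q permutes S.
      if (\<forall>k\<in>insert a S. c ((transpose a b \<circ> q) k) = c k) then W (insert a S) (transpose a b \<circ> q) else 0)"
    by (rule sum_over_permutations_insert[OF insert.hyps])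
  also have "\<dots> = (\<Sum>b\<in>insert a S. if c b = c a then (if b = a then ?d else 1) * sum (W S) (G S) else 0)"
    by (intro sum.cong refl step)
  also have "\<dots> = ?d * sum (W S) (G S) + (\<Sum>b\<in>S. if c b = c a then sum (W S) (G S) else 0)"
    using insert.hyps by (auto intro!: sum.cong)
  also have "(\<Sum>b\<in>S. if c b = c a then sum (W S) (G S) else 0) = real (?m S (c a)) * sum (W S) (G S)"
    using insert.hyps by (simp add: sum.inter_filter[symmetric])
  also have "sum (W S) (G S) = (\<Prod>v\<in>V. pochhammer ?d (?m S v))"
    unfolding W_def G_def by (rule insert.IH) (use insert.prems in simp)
  also have "\<dots> = pochhammer ?d (?m S (c a)) * (\<Prod>v\<in>V - {c a}. pochhammer ?d (?m S v))"
    using insert.prems assms by (intro prod.remove) auto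
  also have "?d * (pochhammer ?d (?m S (c a)) * (\<Prod>v\<in>V - {c a}. pochhammer ?d (?m S v))) +
      real (?m S (c a)) * (pochhammer ?d (?m S (c a)) * (\<Prod>v\<in>V - {c a}. pochhammer ?d (?m S v)))
    = pochhammer ?d (Suc (?m S (c a))) * (\<Prod>v\<in>V - {c a}. pochhammer ?d (?m S v))"
    by (simp add: pochhammer_Suc algebra_simps)
  also have "Suc (?m S (c a)) = ?m (insert a S) (c a)"
  proof -
    have "{k \<in> insert a S. c k = c a} = insert a {k \<in> S. c k = c a}" by auto
    then show ?thesis using insert.hyps by simp
  qed
  also have "(\<Prod>v\<in>V - {c a}. pochhammer ?d (?m S v)) = (\<Prod>v\<in>V - {c a}. pochhammer ?d (?m (insert a S) v))"
    by (intro prod.cong refl arg_cong[where f = "pochhammer ?d"] arg_cong[where f = card]) auto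
  also have "pochhammer ?d (?m (insert a S) (c a)) * (\<Prod>v\<in>V - {c a}. pochhammer ?d (?m (insert a S) v))
      = (\<Prod>v\<in>V. pochhammer ?d (?m (insert a S) v))"
    using insert.prems assms by (intro prod.remove[symmetric]) auto
  finally show ?case unfolding W_def G_def .
qed

section \<open>One step of the lumped chain\<close>

text \<open>
  This is \<open>binom(2m, m) / 4\<^sup>m\<close> (\<open>arcsine_weight_eq_choose\<close>). The Pochhammer form is the one in which
  it arises, and in which the Chu--Vandermonde identity applies to it.
\<close>

definition arcsine_weight :: "nat \<Rightarrow> real" where
  "arcsine_weight m = pochhammer (1 / 2) m / fact m"

lemma stabilizer_altdef:
  "stabilizer n x = {g. g permutes {..<n} \<and> (\<forall>k\<in>{..<n}. x (g k) = x k)}"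
  by (auto simp: stabilizer_def fun_eq_iff) (metis lessThan_iff permutes_def)

lemma word_values: "x \<in> words n \<Longrightarrow> k < n \<Longrightarrow> x k = 0 \<or> x k = 1"
  by (auto simp: words_def PiE_iff)

lemma card_zeros: "x \<in> words n \<Longrightarrow> card {k \<in> {..<n}. x k = 0} = n - weight n x"
proof -
  assume x: "x \<in> words n"
  then have "{k \<in> {..<n}. x k = 0} = {..<n} - {k. k < n \<and> x k = 1}"
    using word_values[OF x] by force
  then show ?thesis by (simp add: card_Diff_subset weight_def subset_iff)
qed

lemma card_stabilizer:
  assumes "x \<in> words n"
  shows "real (card (stabilizer n x)) = fact (weight n x) * fact (n - weight n x)"
proof -
  \<comment> \<open>With a single colour every permutation has exactly one invariant colouring.\<close>
  have const: "{y \<in> {..<n} \<rightarrow>\<^sub>E {()}. y \<circ> g = y} = {\<lambda>k. ()}" for g :: "nat \<Rightarrow> nat"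
    by (auto simp: fun_eq_iff PiE_iff extensional_def)
  have "x ` {..<n} \<subseteq> {0, 1}" using word_values[OF assms] by force
  from sum_inverse_card_invariant_colourings[OF _ _ this, of "{()}"]
  have "real (card (stabilizer n x)) =
    pochhammer 1 (card {k \<in> {..<n}. x k = 0}) * pochhammer 1 (card {k \<in> {..<n}. x k = 1})"
    unfolding const by (simp add: stabilizer_altdef)
  moreover have "card {k \<in> {..<n}. x k = 1} = weight n x" by (simp add: weight_def)
  ultimately show ?thesis by (simp only: card_zeros[OF assms] pochhammer_fact[symmetric]) simp
qed

text \<open>
  The permutations that stabilize both words are those that preserve the labelling
  \<open>k \<mapsto> (x k, y k)\<close>.
\<close>

lemma burnside_kernel_eq_prod:
  assumes "x \<in> words n" "y \<in> words n"
  shows "burnside_kernel n x y = (\<Prod>v\<in>{0, 1} \<times> {0, 1}. pochhammer (1 / 2) (card {k \<in> {..<n}. (x k, y k) = v}))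
    / (fact (weight n x) * fact (n - weight n x))"
proof -
  have "(\<lambda>k. (x k, y k)) ` {..<n} \<subseteq> {0, 1} \<times> {0, 1}"
    using word_values assms by fastforce
  from sum_inverse_card_invariant_colourings[OF _ _ this, of "{0, 1 :: nat}"]
  have "(\<Sum>g \<in> stabilizer n x \<inter> stabilizer n y. 1 / real (card (fixed_words n g)))
     = (\<Prod>v\<in>{0, 1} \<times> {0, 1}. pochhammer (1 / 2) (card {k \<in> {..<n}. (x k, y k) = v}))"
    by (simp add: fixed_words_def words_def stabilizer_altdef Collect_conj_eq[symmetric] conj_ac
       ball_conj_distrib del: insert_Times_insert)
  then show ?thesis
    unfolding burnside_kernel_def card_stabilizer[OF assms(1)] sum_distrib_left[symmetric] by simp
qed

lemma sum_Pow_card: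
  fixes h :: "nat \<Rightarrow> real"
  assumes "finite X"
  shows "(\<Sum>A\<in>Pow X. h (card A)) = (\<Sum>a\<le>card X. real (card X choose a) * h a)"
proof -
  have "(\<Sum>A\<in>Pow X. h (card A)) = (\<Sum>a\<le>card X. \<Sum>A\<in>{A \<in> Pow X. card A = a}. h (card A))"
    using assms by (intro sum.group[symmetric]) (auto intro: card_mono)
  also have "\<dots> = (\<Sum>a\<le>card X. real (card X choose a) * h a)"
    using n_subsets[OF assms] by (intro sum.cong) auto
  finally show ?thesis .
qed

lemma bij_betw_words:
  assumes "X \<subseteq> {..<n}"
  shows "bij_betw (\<lambda>(A, B). \<lambda>k\<in>{..<n}. if k \<in> A \<union> B then 1 else 0) (Pow X \<times> Pow ({..<n} - X)) (words n)"
proof (rule bij_betw_byWitness[where f' = "\<lambda>y. ({k \<in> X. y k = 1}, {k \<in> {..<n} - X. y k = 1})"])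
  let ?w = "\<lambda>(A, B). \<lambda>k\<in>{..<n}. if k \<in> A \<union> B then 1 else (0 :: nat)"
  show "\<forall>p\<in>Pow X \<times> Pow ({..<n} - X). ({k \<in> X. ?w p k = 1}, {k \<in> {..<n} - X. ?w p k = 1}) = p"
    using assms by (auto split: if_splits)
  show "\<forall>y\<in>words n. ?w ({k \<in> X. y k = 1}, {k \<in> {..<n} - X. y k = 1}) = y"
    by (force simp: words_def fun_eq_iff PiE_iff extensional_def)
  show "?w ` (Pow X \<times> Pow ({..<n} - X)) \<subseteq> words n"
    by (auto simp: words_def PiE_iff split: if_splits)
  show "(\<lambda>y. ({k \<in> X. y k = 1}, {k \<in> {..<n} - X. y k = 1})) ` words n \<subseteq> Pow X \<times> Pow ({..<n} - X)"
    by auto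
qed

text \<open>
  Let \<open>X\<close> be the set of ones of \<open>x\<close>. A word \<open>y\<close> is given by the ones that it has inside \<open>X\<close> and
  outside \<open>X\<close>, and the kernel depends only on the sizes \<open>a\<close> and \<open>b\<close> of these two sets. The
  binomial coefficients that count the sets turn the factors \<open>(1/2)\<^sub>a (1/2)\<^sub>i\<^sub>-\<^sub>a / i!\<close> into a product of
  two arcsine weights.
\<close>

lemma burnside_expectation:
  assumes x: "x \<in> words n" and i: "weight n x = i"
  shows "(\<Sum>y\<in>words n. burnside_kernel n x y * f (weight n y))
    = (\<Sum>a\<le>i. \<Sum>b\<le>n - i. arcsine_weight a * arcsine_weight (i - a) *
         (arcsine_weight b * arcsine_weight (n - i - b)) * f (a + b))"
proof -
  define X where "X = {k. k < n \<and> x k = 1}"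
  let ?w = "\<lambda>A B. \<lambda>k\<in>{..<n}. if k \<in> A \<union> B then 1 else (0 :: nat)"
  have X: "X \<subseteq> {..<n}" and cX: "card X = i" using i by (auto simp: X_def weight_def)
  have finX: "finite X" using X finite_subset by blast
  have cX': "card ({..<n} - X) = n - i" using X cX finX by (simp add: card_Diff_subset)
  have x01: "x k = 0 \<longleftrightarrow> x k \<noteq> 1" if "k < n" for k using x that by (auto simp: words_def PiE_iff)
  define p where "p = pochhammer (1 / 2 :: real)"
  define h where "h = (\<lambda>a b. p a * p (i - a) * (p b * p (n - i - b)) / (fact i * fact (n - i)) * f (a + b))"
  have main: "burnside_kernel n x (?w A B) * f (weight n (?w A B)) = h (card A) (card B)"
    if "A \<in> Pow X" "B \<in> Pow ({..<n} - X)" for A B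
  proof -
    have fin: "finite A" "finite B" using that X finX by (auto intro: finite_subset)
    have w: "?w A B \<in> words n" by (auto simp: words_def PiE_iff)
    have "{k. k < n \<and> ?w A B k = 1} = A \<union> B" using that X by (auto split: if_splits)
    then have wt: "weight n (?w A B) = card A + card B"
      using that fin by (simp add: weight_def) (subst card_Un_disjoint, auto)
    have "{k \<in> {..<n}. (x k, ?w A B k) = (1, 1)} = A"
      using that by (auto simp: X_def split: if_splits)
    moreover have "{k \<in> {..<n}. (x k, ?w A B k) = (1, 0)} = X - A"
      using that by (auto simp: X_def split: if_splits)
    moreover have "{k \<in> {..<n}. (x k, ?w A B k) = (0, 1)} = B"
      using that x01 by (auto simp: X_def split: if_splits)
    moreover have "{k \<in> {..<n}. (x k, ?w A B k) = (0, 0)} = ({..<n} - X) - B"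
      using that x01 by (auto simp: X_def split: if_splits)
    moreover have "card (X - A) = i - card A" "card (({..<n} - X) - B) = n - i - card B"
      using that fin cX cX' by (simp_all add: card_Diff_subset)
    ultimately have "burnside_kernel n x (?w A B) =
        p (card A) * p (i - card A) * (p (card B) * p (n - i - card B)) / (fact i * fact (n - i))"
      unfolding burnside_kernel_eq_prod[OF x w] i by (simp add: p_def sum.cartesian_product mult_ac)
    then show ?thesis unfolding wt h_def by simp
  qed
  have "(\<Sum>y\<in>words n. burnside_kernel n x y * f (weight n y))
     = (\<Sum>(A, B)\<in>Pow X \<times> Pow ({..<n} - X). burnside_kernel n x (?w A B) * f (weight n (?w A B)))"
    using sum.reindex_bij_betw[OF bij_betw_words[OF X], of "\<lambda>y. burnside_kernel n x y * f (weight n y)"]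
    by (simp add: case_prod_unfold)
  also have "\<dots> = (\<Sum>A\<in>Pow X. \<Sum>B\<in>Pow ({..<n} - X). h (card A) (card B))"
    unfolding sum.cartesian_product[symmetric] by (intro sum.cong refl main)
  also have "\<dots> = (\<Sum>A\<in>Pow X. \<Sum>b\<le>n - i. real ((n - i) choose b) * h (card A) b)"
    using sum_Pow_card[of "{..<n} - X"] by (simp add: cX')
  also have "\<dots> = (\<Sum>a\<le>i. real (i choose a) * (\<Sum>b\<le>n - i. real ((n - i) choose b) * h a b))"
    using sum_Pow_card[OF finX, of "\<lambda>a. \<Sum>b\<le>n - i. real ((n - i) choose b) * h a b"] by (simp add: cX)
  also have "\<dots> = (\<Sum>a\<le>i. \<Sum>b\<le>n - i. arcsine_weight a * arcsine_weight (i - a) *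
         (arcsine_weight b * arcsine_weight (n - i - b)) * f (a + b))"
    unfolding sum_distrib_left
    by (intro sum.cong refl) (simp add: h_def p_def arcsine_weight_def binomial_fact field_simps)
  finally show ?thesis .
qed

lemma finite_words: "finite (words n)"
  by (auto simp: words_def intro: finite_PiE)

lemma weight_le: "weight n y \<le> n"
proof -
  have "{k. k < n \<and> y k = 1} \<subseteq> {..<n}" by auto
  from card_mono[OF _ this] show ?thesis by (simp add: weight_def)
qed

lemma burnside_lumped_apply:
  assumes "i \<le> n"
  shows "(\<Sum>j\<le>n. burnside_lumped n $$ (i, j) * f j)
    = (\<Sum>a\<le>i. \<Sum>b\<le>n - i. arcsine_weight a * arcsine_weight (i - a) *
         (arcsine_weight b * arcsine_weight (n - i - b)) * f (a + b))"
proof -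
  obtain x where x: "x \<in> words n" "weight n x = i" using ex_word_of_weight[OF assms] by blast
  have "(\<Sum>j\<le>n. burnside_lumped n $$ (i, j) * f j)
      = (\<Sum>j\<le>n. \<Sum>y\<in>{y \<in> words n. weight n y = j}. burnside_kernel n x y * f (weight n y))"
    using burnside_lumped_eq[OF x assms] by (auto simp: sum_distrib_right intro!: sum.cong)
  also have "\<dots> = (\<Sum>y\<in>words n. burnside_kernel n x y * f (weight n y))"
    using finite_words weight_le by (intro sum.group) auto
  finally show ?thesis unfolding burnside_expectation[OF x] .
qed

text \<open>
  The guards say that the four block sizes \<open>a\<close>, \<open>i - a\<close>, \<open>j - a\<close> and \<open>n + a - (i + j)\<close> are
  non-negative. In this form the symmetry in \<open>i\<close> and \<open>j\<close> is visible.
\<close>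

lemma burnside_lumped_entry:
  assumes "i \<le> n" "j \<le> n"
  shows "burnside_lumped n $$ (i, j) = (\<Sum>a\<le>n. if a \<le> i \<and> a \<le> j \<and> i + j \<le> n + a then
     arcsine_weight a * arcsine_weight (i - a) * (arcsine_weight (j - a) * arcsine_weight (n + a - (i + j))) else 0)"
proof -
  have "burnside_lumped n $$ (i, j) = (\<Sum>l\<le>n. burnside_lumped n $$ (i, l) * (if l = j then 1 else 0))"
    using assms by (simp add: if_distrib cong: if_cong)
  also have "\<dots> = (\<Sum>a\<le>i. \<Sum>b\<le>n - i. if b = j - a then (if a \<le> j then arcsine_weight a * arcsine_weight (i - a) *
         (arcsine_weight b * arcsine_weight (n - i - b)) else 0) else 0)"
    unfolding burnside_lumped_apply[OF assms(1)] by (intro sum.cong refl) auto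
  also have "\<dots> = (\<Sum>a\<le>i. if a \<le> j \<and> i + j \<le> n + a then
     arcsine_weight a * arcsine_weight (i - a) * (arcsine_weight (j - a) * arcsine_weight (n + a - (i + j))) else 0)"
    using assms by (intro sum.cong refl) (auto simp: algebra_simps)
  also have "\<dots> = (\<Sum>a\<le>n. if a \<le> i \<and> a \<le> j \<and> i + j \<le> n + a then
     arcsine_weight a * arcsine_weight (i - a) * (arcsine_weight (j - a) * arcsine_weight (n + a - (i + j))) else 0)"
    using assms by (intro sum.mono_neutral_cong_left) auto
  finally show ?thesis .
qed

lemma burnside_lumped_sym:
  assumes "i \<le> n" "j \<le> n"
  shows "burnside_lumped n $$ (i, j) = burnside_lumped n $$ (j, i)"
  unfolding burnside_lumped_entry[OF assms] burnside_lumped_entry[OF assms(2,1)]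
  by (intro sum.cong refl if_cong) (auto simp: add.commute mult_ac)

section \<open>Binomial moments\<close>

text \<open>
  The factor \<open>binom(a, r)\<close> absorbs the first \<open>r\<close> factors of \<open>(1/2)\<^sub>a\<close> and leaves \<open>(r + 1/2)\<^sub>a\<^sub>-\<^sub>r\<close>.
  The rest is the Chu--Vandermonde sum for \<open>(r + 1/2) + 1/2 = r + 1\<close>.
\<close>

lemma arcsine_binomial_moment:
  "(\<Sum>a\<le>i. arcsine_weight a * arcsine_weight (i - a) * real (a choose r))
   = arcsine_weight r * real (i choose r)"
proof (cases "r \<le> i")
  case True
  let ?p = "pochhammer :: real \<Rightarrow> nat \<Rightarrow> real"
  have "(\<Sum>a\<le>i. arcsine_weight a * arcsine_weight (i - a) * real (a choose r))
     = (\<Sum>a\<in>{r..i}. arcsine_weight a * arcsine_weight (i - a) * real (a choose r))"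
    by (intro sum.mono_neutral_right) (auto simp: binomial_eq_0)
  also have "\<dots> = (\<Sum>s\<le>i - r. arcsine_weight (r + s) * arcsine_weight (i - r - s) * real ((r + s) choose r))"
    using True by (intro sum.reindex_bij_witness[of _ "\<lambda>s. r + s" "\<lambda>a. a - r"]) auto
  also have "\<dots> = (\<Sum>s\<le>i - r. arcsine_weight r / fact (i - r) *
      (real ((i - r) choose s) * ?p (1 / 2 + r) s * ?p (1 / 2) (i - r - s)))"
  proof (intro sum.cong refl)
    fix s assume "s \<in> {..i - r}"
    then have s: "s \<le> i - r" by simp
    show "arcsine_weight (r + s) * arcsine_weight (i - r - s) * real ((r + s) choose r)
      = arcsine_weight r / fact (i - r) * (real ((i - r) choose s) * ?p (1 / 2 + r) s * ?p (1 / 2) (i - r - s))"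
      unfolding arcsine_weight_def pochhammer_product' binomial_fact[OF s, where 'a = real]
        binomial_fact[OF le_add1, where 'a = real]
      by (simp add: field_simps)
  qed
  also have "\<dots> = arcsine_weight r / fact (i - r) * ?p (1 / 2 + r + 1 / 2) (i - r)"
    by (simp only: pochhammer_binomial_sum sum_distrib_left)
  also have "?p (1 / 2 + r + 1 / 2) (i - r) = fact i / fact r"
  proof -
    have "1 / 2 + real r + 1 / 2 = 1 + real r" by simp
    then show ?thesis
      using pochhammer_product[OF True, of "1 :: real"]
      by (simp only: pochhammer_fact[symmetric]) (simp add: field_simps)
  qed
  also have "arcsine_weight r / fact (i - r) * (fact i / fact r) = arcsine_weight r * real (i choose r)"
    using True by (simp add: binomial_fact field_simps)
  finally show ?thesis .
next
  case False
  then show ?thesis by (auto simp: binomial_eq_0 intro!: sum.neutral)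
qed

lemma burnside_lumped_binomial:
  assumes "i \<le> n"
  shows "(\<Sum>j\<le>n. burnside_lumped n $$ (i, j) * real (j choose d))
    = (\<Sum>r\<le>d. arcsine_weight r * arcsine_weight (d - r) * (real (i choose r) * real ((n - i) choose (d - r))))"
proof -
  let ?A = "\<lambda>i a. arcsine_weight a * arcsine_weight (i - a)"
  have "(\<Sum>j\<le>n. burnside_lumped n $$ (i, j) * real (j choose d))
     = (\<Sum>a\<le>i. \<Sum>b\<le>n - i. \<Sum>r\<le>d. (?A i a * real (a choose r)) * (?A (n - i) b * real (b choose (d - r))))"
    unfolding burnside_lumped_apply[OF assms] vandermonde[symmetric] of_nat_sum sum_distrib_left
    by (intro sum.cong refl) simp
  also have "\<dots> = (\<Sum>r\<le>d. \<Sum>a\<le>i. \<Sum>b\<le>n - i. (?A i a * real (a choose r)) * (?A (n - i) b * real (b choose (d - r))))"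
    by (subst sum.swap, subst (2) sum.swap, rule refl)
  also have "\<dots> = (\<Sum>r\<le>d. (\<Sum>a\<le>i. ?A i a * real (a choose r)) * (\<Sum>b\<le>n - i. ?A (n - i) b * real (b choose (d - r))))"
    by (simp only: sum_product)
  also have "\<dots> = (\<Sum>r\<le>d. arcsine_weight r * arcsine_weight (d - r) * (real (i choose r) * real ((n - i) choose (d - r))))"
    by (simp only: arcsine_binomial_moment) (simp add: mult_ac)
  finally show ?thesis .
qed

section \<open>Polynomials on an interval of integers\<close>

definition binomial_poly :: "nat \<Rightarrow> real poly" where
  "binomial_poly r = Polynomial.smult (1 / fact r) (\<Prod>i<r. [:- real i, 1:])"

lemma poly_binomial_poly: "poly (binomial_poly r) x = x gchoose r"
  by (simp add: binomial_poly_def poly_prod gbinomial_prod_rev lessThan_atLeast0)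

lemma poly_binomial_poly_of_nat [simp]: "poly (binomial_poly r) (real i) = real (i choose r)"
  by (simp add: poly_binomial_poly binomial_gbinomial)

lemma degree_binomial_poly [simp]: "degree (binomial_poly r) = r"
  by (simp add: binomial_poly_def degree_prod_eq_sum_degree)

lemma coeff_binomial_poly [simp]: "coeff (binomial_poly r) r = 1 / fact r"
proof -
  have "lead_coeff (binomial_poly r) = 1 / fact r"
    unfolding binomial_poly_def lead_coeff_smult lead_coeff_prod by simp
  then show ?thesis by simp
qed

definition reflected_binomial_poly :: "nat \<Rightarrow> nat \<Rightarrow> real poly" where
  "reflected_binomial_poly n r = pcompose (binomial_poly r) [:real n, -1:]"

lemma poly_reflected_binomial_poly [simp]:
  "i \<le> n \<Longrightarrow> poly (reflected_binomial_poly n r) (real i) = real ((n - i) choose r)"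
  using poly_binomial_poly_of_nat[of r "n - i"]
  by (simp add: reflected_binomial_poly_def poly_pcompose of_nat_diff)

lemma degree_reflected_binomial_poly [simp]: "degree (reflected_binomial_poly n r) = r"
  by (simp add: reflected_binomial_poly_def)

lemma coeff_reflected_binomial_poly [simp]:
  "coeff (reflected_binomial_poly n r) r = (- 1) ^ r / fact r"
proof -
  have "lead_coeff (reflected_binomial_poly n r) = (- 1) ^ r / fact r"
    unfolding reflected_binomial_poly_def by (subst lead_coeff_comp) auto
  then show ?thesis by simp
qed

text \<open>
  Polynomials of degree below \<open>m\<close> form the span of any family \<open>B\<close> with one member of each degree.
  The degree bound is written as vanishing of the coefficients from \<open>m\<close> on, which for \<open>m = 0\<close> leaves
  only the zero polynomial, the base of the induction.
\<close>

lemma graded_poly_induct: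
  fixes p :: "real poly"
  assumes "\<And>i. i \<ge> m \<Longrightarrow> coeff p i = 0"
    and "P 0" and add: "\<And>p q. P p \<Longrightarrow> P q \<Longrightarrow> P (p + q)" and smult: "\<And>c p. P p \<Longrightarrow> P (Polynomial.smult c p)"
    and B: "\<And>k. k < m \<Longrightarrow> P (B k)" "\<And>k. k < m \<Longrightarrow> degree (B k) = k" "\<And>k. k < m \<Longrightarrow> coeff (B k) k \<noteq> 0"
  shows "P p"
  using assms(1) B
proof (induction m arbitrary: p)
  case 0
  then have "p = 0" by (simp add: poly_eq_iff)
  with \<open>P 0\<close> show ?case by simp
next
  case (Suc m)
  define q where "q = p - Polynomial.smult (coeff p m / coeff (B m) m) (B m)"
  have q: "coeff q i = 0" if "i \<ge> m" for i
  proof (cases "i = m")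
    case True
    then show ?thesis using Suc.prems(4)[of m] by (simp add: q_def)
  next
    case False
    then have "coeff p i = 0" "coeff (B m) i = 0"
      using that Suc.prems(1)[of i] Suc.prems(3)[of m] by (auto simp: coeff_eq_0)
    then show ?thesis by (simp add: q_def)
  qed
  have "P q" by (rule Suc.IH) (simp_all only: q Suc.prems(2-4) less_SucI simp_thms)
  then have "P (q + Polynomial.smult (coeff p m / coeff (B m) m) (B m))"
    by (rule add[OF _ smult]) (simp add: Suc.prems(2))
  then show ?case by (simp add: q_def)
qed

text \<open>
  The sum is, up to sign, the \<open>d\<close>-th finite difference of \<open>p\<close> at \<open>0\<close>, and each difference lowers the
  degree by one.
\<close>

lemma alternating_sum_binomial_poly:
  fixes p :: "real poly"
  assumes "\<And>i. i \<ge> d \<Longrightarrow> coeff p i = 0"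
  shows "(\<Sum>l\<le>d. (- 1) ^ l * real (d choose l) * poly p (real l)) = 0"
  using assms
proof (rule graded_poly_induct[where B = binomial_poly and m = d])
  show "(\<Sum>l\<le>d. (- 1) ^ l * real (d choose l) * poly (binomial_poly k) (real l)) = 0" if "k < d" for k
  proof -
    have "(\<Sum>l\<le>d. (- 1) ^ l * real (d choose l) * poly (binomial_poly k) (real l))
        = (\<Sum>l\<in>{k..d}. (- 1) ^ l * real (d choose l) * poly (binomial_poly k) (real l))"
      by (intro sum.mono_neutral_right) (auto simp: binomial_eq_0)
    also have "\<dots> = (\<Sum>s\<le>d - k. (- 1) ^ k * real (d choose k) * ((- 1) ^ s * real ((d - k) choose s)))"
    proof (rule sum.reindex_bij_witness[of _ "\<lambda>s. k + s" "\<lambda>l. l - k"])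
      fix l assume "l \<in> {k..d}"
      then have "real (d choose l) * real (l choose k) = real (d choose k) * real ((d - k) choose (l - k))"
        and "(- 1 :: real) ^ l = (- 1) ^ k * (- 1) ^ (l - k)"
        by (simp_all add: choose_mult flip: of_nat_mult power_add)
      then show "(- 1) ^ k * real (d choose k) * ((- 1) ^ (l - k) * real ((d - k) choose (l - k)))
         = (- 1) ^ l * real (d choose l) * poly (binomial_poly k) (real l)"
        by (simp add: mult_ac)
    qed (use that in auto)
    also have "\<dots> = 0"
      using that choose_alternating_sum[of "d - k", where 'a = real] by (simp flip: sum_distrib_left)
    finally show ?thesis .
  qed
next
  show "(\<Sum>l\<le>d. (- 1) ^ l * real (d choose l) * poly (p + q) (real l)) = 0"
    if "(\<Sum>l\<le>d. (- 1) ^ l * real (d choose l) * poly p (real l)) = 0"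
       "(\<Sum>l\<le>d. (- 1) ^ l * real (d choose l) * poly q (real l)) = 0" for p q
    using that by (simp add: distrib_left sum.distrib)
next
  show "(\<Sum>l\<le>d. (- 1) ^ l * real (d choose l) * poly (Polynomial.smult c p) (real l)) = 0"
    if "(\<Sum>l\<le>d. (- 1) ^ l * real (d choose l) * poly p (real l)) = 0" for c p
  proof -
    have "(\<Sum>l\<le>d. (- 1) ^ l * real (d choose l) * poly (Polynomial.smult c p) (real l))
      = c * (\<Sum>l\<le>d. (- 1) ^ l * real (d choose l) * poly p (real l))"
      by (simp add: sum_distrib_left mult_ac)
    with that show ?thesis by simp
  qed
qed simp_all

text \<open>
  Both sides count the subsets of \<open>{0, \<dots>, n}\<close> with \<open>l + m + 1\<close> elements, on the left
  according to the element \<open>i\<close> that has exactly \<open>l\<close> others below it. The proof inducts on \<open>n\<close> with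
  Pascal's rule.
\<close>

lemma sum_choose_product:
  "(\<Sum>i\<le>n. (i choose l) * ((n - i) choose m)) = Suc n choose (l + m + 1)"
proof (induction n arbitrary: m)
  case 0
  then show ?case by (cases l; cases m; simp)
next
  case (Suc n)
  show ?case
  proof (cases m)
    case 0
    then show ?thesis using sum_choose_upper[of l "Suc n"] by simp
  next
    case m: (Suc m')
    have "(\<Sum>i\<le>Suc n. (i choose l) * ((Suc n - i) choose m))
       = (\<Sum>i\<le>n. (i choose l) * ((n - i) choose m)) + (\<Sum>i\<le>n. (i choose l) * ((n - i) choose m'))"
      by (simp add: m Suc_diff_le distrib_left sum.distrib)
    also have "\<dots> = Suc (Suc n) choose (l + m + 1)"
      unfolding Suc.IH by (simp add: m)
    finally show ?thesis .
  qed
qed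

section \<open>Orthogonality of the discrete Chebyshev polynomials\<close>

lemma pochhammer_neg_of_nat: "pochhammer (- real m) l = (- 1) ^ l * fact l * real (m choose l)"
  by (simp add: binomial_gbinomial gbinomial_pochhammer)

lemma discrete_chebyshev_of_nat:
  assumes "j \<le> n"
  shows "discrete_chebyshev n j (real i)
   = (\<Sum>l\<le>j. (- 1) ^ l * real (j choose l) * real ((j + l) choose l) / real (n choose l) * real (i choose l))"
  unfolding discrete_chebyshev_def atLeast0AtMost
proof (intro sum.cong refl)
  fix l assume "l \<in> {..j}"
  have "pochhammer (real j + 1) l = fact (j + l) / fact j"
    using pochhammer_product'[of "1 :: real" j l] by (simp add: pochhammer_fact[symmetric] add_ac)
  also have "\<dots> = fact l * real ((j + l) choose l)"
    using binomial_fact[of l "j + l", where 'a = real] by simp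
  finally show "pochhammer (- real j) l * pochhammer (real j + 1) l * pochhammer (- real i) l
        / ((fact l)\<^sup>2 * pochhammer (- real n) l)
      = (- 1) ^ l * real (j choose l) * real ((j + l) choose l) / real (n choose l) * real (i choose l)"
    by (simp add: pochhammer_neg_of_nat power2_eq_square)
qed

definition chebyshev_poly :: "nat \<Rightarrow> nat \<Rightarrow> real poly" where
  "chebyshev_poly n j = (\<Sum>l\<le>j. Polynomial.smult ((- 1) ^ l * real (j choose l) * real ((j + l) choose l) / real (n choose l))
     (binomial_poly l))"

lemma poly_chebyshev_poly:
  "j \<le> n \<Longrightarrow> poly (chebyshev_poly n j) (real i) = discrete_chebyshev n j (real i)"
  by (simp add: chebyshev_poly_def poly_sum discrete_chebyshev_of_nat)

lemma coeff_chebyshev_poly_above: "i > j \<Longrightarrow> coeff (chebyshev_poly n j) i = 0"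
  by (simp add: chebyshev_poly_def coeff_sum coeff_eq_0)

lemma coeff_chebyshev_poly_top:
  "coeff (chebyshev_poly n j) j = (- 1) ^ j * real ((2 * j) choose j) / real (n choose j) / fact j"
proof -
  have "coeff (chebyshev_poly n j) j = (\<Sum>l\<le>j. if l = j then
     (- 1) ^ j * real ((2 * j) choose j) / real (n choose j) / fact j else 0)"
    unfolding chebyshev_poly_def coeff_sum
    by (intro sum.cong refl) (auto simp: coeff_eq_0 mult_2)
  then show ?thesis by simp
qed

text \<open>
  It suffices to test against \<open>binom(n - x, m)\<close> for \<open>m < d\<close>. Summing over \<open>x\<close> first turns
  \<open>binom(x, l)\<close> into \<open>binom(n + 1, l + m + 1)\<close>. Multiplied by \<open>binom(d + l, l) / binom(n, l)\<close> this is, up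
  to a factor that does not depend on \<open>l\<close>, the value \<open>binom(d + l, d - m - 1) binom(n - l, m)\<close> of a
  polynomial in \<open>l\<close> of degree \<open>d - 1\<close>, and its \<open>d\<close>-th finite difference is zero.
\<close>

lemma chebyshev_orthogonal:
  assumes "d \<le> n" and "\<And>i. i \<ge> d \<Longrightarrow> coeff p i = 0"
  shows "(\<Sum>i\<le>n. discrete_chebyshev n d (real i) * poly p (real i)) = 0"
  using assms(2)
proof (rule graded_poly_induct[where B = "reflected_binomial_poly n" and m = d])
  fix m assume m: "m < d"
  let ?c = "\<lambda>l. (- 1) ^ l * real (d choose l) * real ((d + l) choose l) / real (n choose l)"
  \<comment> \<open>The value of this polynomial at \<open>l\<close> is \<open>binom(d + l, d - m - 1) binom(n - l, m)\<close>.\<close>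
  define R where "R = pcompose (binomial_poly (d - m - 1)) [:real d, 1:] * reflected_binomial_poly n m"
  have "degree R \<le> degree (pcompose (binomial_poly (d - m - 1)) [:real d, 1:]) + degree (reflected_binomial_poly n m)"
    unfolding R_def by (rule degree_mult_le)
  also have "\<dots> = d - 1" using m by simp
  finally have "degree R < d" using m by simp
  then have R0: "(\<Sum>l\<le>d. (- 1) ^ l * real (d choose l) * poly R (real l)) = 0"
    by (intro alternating_sum_binomial_poly) (auto simp: coeff_eq_0)
  have R: "poly R (real l) = real ((d + l) choose (d - m - 1)) * real ((n - l) choose m)" if "l \<le> d" for l
    using that assms(1) poly_binomial_poly_of_nat[of "d - m - 1" "d + l"]
    by (simp add: R_def poly_pcompose)
  let ?C = "real (n + 1) * fact (d - m - 1) * fact m / fact d"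
  have "(\<Sum>i\<le>n. discrete_chebyshev n d (real i) * poly (reflected_binomial_poly n m) (real i))
     = (\<Sum>i\<le>n. \<Sum>l\<le>d. ?c l * (real (i choose l) * real ((n - i) choose m)))"
    unfolding discrete_chebyshev_of_nat[OF assms(1)] sum_distrib_right
    by (intro sum.cong refl) simp
  also have "\<dots> = (\<Sum>l\<le>d. ?c l * real (\<Sum>i\<le>n. (i choose l) * ((n - i) choose m)))"
    by (subst sum.swap) (simp add: sum_distrib_left)
  also have "\<dots> = (\<Sum>l\<le>d. ?C * ((- 1) ^ l * real (d choose l) * poly R (real l)))"
  proof (intro sum.cong refl)
    fix l assume "l \<in> {..d}"
    then have l: "l \<le> d" "l \<le> n" using assms(1) by auto
    have key: "real ((d + l) choose l) / real (n choose l) * real (Suc n choose (l + m + 1)) = ?C * poly R (real l)"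
    \<comment> \<open>If \<open>m > n - l\<close>, both sides are zero; the formulas with factorials need the other case.\<close>
    proof (cases "m \<le> n - l")
      case True
      have a: "real ((d + l) choose l) = fact (d + l) / (fact l * fact d)"
        using binomial_fact[of l "d + l", where 'a = real] by simp
      have b: "real (n choose l) = fact n / (fact l * fact (n - l))"
        using l by (simp add: binomial_fact)
      have c: "real (Suc n choose (l + m + 1)) = real (n + 1) * fact n / (fact (l + m + 1) * fact (n - l - m))"
        using binomial_fact[of "l + m + 1" "Suc n", where 'a = real] True l by simp
      have "d + l - (d - m - 1) = l + m + 1" using m by simp
      then have e: "real ((d + l) choose (d - m - 1)) = fact (d + l) / (fact (d - m - 1) * fact (l + m + 1))"
        using binomial_fact[of "d - m - 1" "d + l", where 'a = real] by simp
      have f: "real ((n - l) choose m) = fact (n - l) / (fact m * fact (n - l - m))"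
        using True by (simp add: binomial_fact)
      show ?thesis unfolding R[OF l(1)] a b c e f by (simp add: field_simps del: fact_Suc)
    next
      case False
      then show ?thesis using l by (simp add: R binomial_eq_0)
    qed
    have "?c l * real (Suc n choose (l + m + 1)) = (- 1) ^ l * real (d choose l) *
        (real ((d + l) choose l) / real (n choose l) * real (Suc n choose (l + m + 1)))"
      by (simp only: times_divide_eq_right times_divide_eq_left mult.assoc)
    then show "?c l * real (\<Sum>i\<le>n. (i choose l) * ((n - i) choose m))
        = ?C * ((- 1) ^ l * real (d choose l) * poly R (real l))"
      unfolding sum_choose_product key by (simp only: mult.left_commute)
  qed
  also have "\<dots> = 0" by (simp only: R0 flip: sum_distrib_left)
  finally show "(\<Sum>i\<le>n. discrete_chebyshev n d (real i) * poly (reflected_binomial_poly n m) (real i)) = 0" .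
next
  show "(\<Sum>i\<le>n. discrete_chebyshev n d (real i) * poly (p + q) (real i)) = 0"
    if "(\<Sum>i\<le>n. discrete_chebyshev n d (real i) * poly p (real i)) = 0"
       "(\<Sum>i\<le>n. discrete_chebyshev n d (real i) * poly q (real i)) = 0" for p q
    using that by (simp add: distrib_left sum.distrib)
next
  show "(\<Sum>i\<le>n. discrete_chebyshev n d (real i) * poly (Polynomial.smult c p) (real i)) = 0"
    if "(\<Sum>i\<le>n. discrete_chebyshev n d (real i) * poly p (real i)) = 0" for c p
  proof -
    have "(\<Sum>i\<le>n. discrete_chebyshev n d (real i) * poly (Polynomial.smult c p) (real i))
      = c * (\<Sum>i\<le>n. discrete_chebyshev n d (real i) * poly p (real i))"
      by (simp add: sum_distrib_left mult_ac)
    with that show ?thesis by simp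
  qed
qed simp_all

section \<open>The eigenvalues\<close>

lemma arcsine_weight_Suc: "arcsine_weight (Suc m) = arcsine_weight m * (1 / 2 + real m) / (real m + 1)"
  by (simp add: arcsine_weight_def pochhammer_Suc add_ac)

lemma arcsine_weight_0 [simp]: "arcsine_weight 0 = 1"
  by (simp add: arcsine_weight_def)

lemma arcsine_weight_pos: "arcsine_weight m > 0"
  by (simp add: arcsine_weight_def pochhammer_pos)

lemma arcsine_weight_eq_choose: "arcsine_weight m = real ((2 * m) choose m) / 2 ^ (2 * m)"
proof -
  have "real ((2 * m) choose m) = fact (2 * m) / (fact m * fact m)"
    using binomial_fact[of m "2 * m", where 'a = real] by simp
  also have "\<dots> = 2 ^ (2 * m) * arcsine_weight m"
    by (simp add: fact_double arcsine_weight_def)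
  finally show ?thesis by simp
qed


text \<open>
  The exponential generating function of the moments \<open>\<alpha>\<^sub>r\<close>; as an analytic function it is
  \<open>e\<^sup>x\<^sup>/\<^sup>2 I\<^sub>0(x/2)\<close>.
\<close>

definition arcsine_fps :: "real fps" where
  "arcsine_fps = Abs_fps (\<lambda>r. arcsine_weight r / fact r)"

text \<open>
  The expansion of the modified Bessel function \<open>I\<^sub>0(x/2)\<close>, see \<open>bessel_fps_nth\<close>.
\<close>

definition bessel_fps :: "real fps" where
  "bessel_fps = arcsine_fps * fps_exp (- 1 / 2)"

lemma arcsine_fps_ode:
  "fps_X * fps_deriv (fps_deriv arcsine_fps) + fps_deriv arcsine_fps
    = fps_X * fps_deriv arcsine_fps + fps_const (1 / 2) * arcsine_fps"
proof (rule fps_ext)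
  fix m
  have "real (m + 1) * (real (m + 1) * fps_nth arcsine_fps (Suc m)) = (real m + 1 / 2) * fps_nth arcsine_fps m"
    by (simp add: arcsine_fps_def arcsine_weight_Suc divide_simps) (simp add: algebra_simps)
  then show "fps_nth (fps_X * fps_deriv (fps_deriv arcsine_fps) + fps_deriv arcsine_fps) m
    = fps_nth (fps_X * fps_deriv arcsine_fps + fps_const (1 / 2) * arcsine_fps) m"
    by (cases m) (simp_all add: algebra_simps)
qed

text \<open>
  Removing the factor \<open>e\<^sup>x\<^sup>/\<^sup>2\<close> kills the term \<open>x F'\<close> in the equation for \<open>F\<close> and leaves Bessel's
  equation \<open>x g'' + g' = x g / 4\<close>. Its recurrence links coefficients that are two
  apart and makes the first one vanish, which is why \<open>g\<close> is even.
\<close>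

lemma bessel_fps_ode:
  "fps_X * fps_deriv (fps_deriv bessel_fps) + fps_deriv bessel_fps = fps_const (1 / 4) * fps_X * bessel_fps"
proof -
  define e where "e = fps_exp (- 1 / 2 :: real)"
  define h where "h = fps_const (1 / 2 :: real)"
  let ?F = arcsine_fps
  have e: "fps_deriv e = - (h * e)" and h: "fps_deriv h = 0"
    by (simp_all add: e_def h_def flip: fps_const_neg)
  have hh: "h * h = fps_const (1 / 4)" "h + h = 1" by (simp_all add: h_def)
  have bessel: "bessel_fps = ?F * e" by (simp add: bessel_fps_def e_def)
  have "fps_X * fps_deriv (fps_deriv bessel_fps) + fps_deriv bessel_fps
     = e * ((fps_X * fps_deriv (fps_deriv ?F) + fps_deriv ?F) - (h + h) * (fps_X * fps_deriv ?F)
        + h * h * fps_X * ?F - h * ?F)"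
    unfolding bessel by (simp add: e h algebra_simps)
  also have "\<dots> = fps_const (1 / 4) * fps_X * bessel_fps"
    unfolding arcsine_fps_ode hh bessel_fps_def by (simp add: algebra_simps e_def h_def)
  finally show ?thesis .
qed

lemma bessel_fps_nth:
  "fps_nth bessel_fps (2 * m) = 1 / (16 ^ m * (fact m)\<^sup>2)" "fps_nth bessel_fps (2 * m + 1) = 0"
proof -
  let ?g = "fps_nth bessel_fps"
  have ode: "real (Suc k) * (real (Suc k) * ?g (Suc k)) = (if k = 0 then 0 else ?g (k - 1) / 4)" for k
    using arg_cong[OF bessel_fps_ode, of "\<lambda>f. fps_nth f k"]
    by (cases k) (simp_all add: mult.assoc algebra_simps)
  have "?g (2 * m) = 1 / (16 ^ m * (fact m)\<^sup>2) \<and> ?g (2 * m + 1) = 0"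
  proof (induction m)
    case 0
    show ?case using ode[of 0] by (simp add: bessel_fps_def arcsine_fps_def fps_mult_nth)
  next
    case (Suc m)
    have a: "real (Suc (2 * m + 1)) * (real (Suc (2 * m + 1)) * ?g (2 * Suc m)) = ?g (2 * m) / 4"
      using ode[of "2 * m + 1"] by simp
    have b: "?g (2 * Suc m + 1) = 0"
      using ode[of "2 * Suc m"] Suc.IH by simp
    have "?g (2 * Suc m) = ?g (2 * m) / (16 * (1 + real m)\<^sup>2)"
    proof -
      have "?g (2 * Suc m) * (16 * (1 + real m)\<^sup>2) = ?g (2 * m)"
        using a by (simp add: power2_eq_square algebra_simps)
      moreover have "16 * (1 + real m)\<^sup>2 \<noteq> 0" by simp
      ultimately show ?thesis by (simp only: eq_divide_eq simp_thms if_False if_True)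
    qed
    also have "\<dots> = 1 / (16 ^ Suc m * (fact (Suc m))\<^sup>2)"
      using Suc.IH by (simp add: power_mult_distrib mult_ac)
    finally show ?case using b by simp
  qed
  then show "?g (2 * m) = 1 / (16 ^ m * (fact m)\<^sup>2)" "?g (2 * m + 1) = 0" by auto
qed

lemma bessel_fps_nth_odd: "odd r \<Longrightarrow> fps_nth bessel_fps r = 0"
  using bessel_fps_nth(2) by (auto elim!: oddE)

lemma arcsine_fps_reflected: "arcsine_fps * (arcsine_fps oo (- fps_X)) = bessel_fps * bessel_fps"
proof -
  let ?e = "\<lambda>c :: real. fps_exp c"
  have one: "?e (- 1 / 2) * ?e (1 / 2) = 1"
    by (simp flip: fps_exp_add_mult)
  have F: "arcsine_fps = bessel_fps * ?e (1 / 2)"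
    unfolding bessel_fps_def mult.assoc one by simp
  have "?e (1 / 2) oo (- fps_X) = ?e (- 1 / 2)"
  proof (rule fps_ext)
    fix k
    have "(- 1 :: real) ^ k * (1 / 2) ^ k = (- 1 / 2) ^ k"
      by (simp only: power_mult_distrib[symmetric]) simp
    then show "fps_nth (?e (1 / 2) oo (- fps_X)) k = fps_nth (?e (- 1 / 2)) k"
      by (simp only: fps_compose_uminus' fps_nth_Abs_fps fps_exp_nth times_divide_eq_right)
  qed
  moreover have "bessel_fps oo (- fps_X) = bessel_fps"
  proof (rule fps_ext)
    fix k
    show "fps_nth (bessel_fps oo (- fps_X)) k = fps_nth bessel_fps k"
    proof (cases "even k")
      case True
      then show ?thesis by (simp add: fps_compose_uminus')
    next
      case False
      then have "fps_nth bessel_fps k = 0" by (rule bessel_fps_nth_odd)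
      then show ?thesis by (simp add: fps_compose_uminus')
    qed
  qed
  ultimately have "arcsine_fps oo (- fps_X) = bessel_fps * ?e (- 1 / 2)"
    by (subst F) (simp add: fps_compose_mult_distrib)
  then have "arcsine_fps * (arcsine_fps oo (- fps_X)) = bessel_fps * bessel_fps * (?e (- 1 / 2) * ?e (1 / 2))"
    by (subst F) (simp add: mult_ac)
  then show ?thesis unfolding one by simp
qed

text \<open>
  The \<open>d\<close>-th moment of \<open>U - V\<close> for independent arcsine variables \<open>U\<close>, \<open>V\<close> on \<open>[0, 1]\<close>, whose \<open>r\<close>-th
  moment is \<open>\<alpha>\<^sub>r\<close>.
\<close>

definition burnside_eigenvalue :: "nat \<Rightarrow> real" where
  "burnside_eigenvalue d = (\<Sum>r\<le>d. (- 1) ^ (d - r) * real (d choose r) * arcsine_weight r * arcsine_weight (d - r))"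

lemma burnside_eigenvalue_fps: "burnside_eigenvalue d = fact d * fps_nth (bessel_fps * bessel_fps) d"
proof -
  have "fact d * fps_nth (arcsine_fps * (arcsine_fps oo (- fps_X))) d = burnside_eigenvalue d"
    unfolding burnside_eigenvalue_def fps_mult_nth sum_distrib_left atLeast0AtMost
    by (intro sum.cong refl) (simp add: fps_compose_uminus' arcsine_fps_def binomial_fact)
  then show ?thesis by (simp add: arcsine_fps_reflected)
qed

lemma burnside_eigenvalue_odd:
  assumes "odd d"
  shows "burnside_eigenvalue d = 0"
proof -
  have "fps_nth bessel_fps r * fps_nth bessel_fps (d - r) = 0" if "r \<le> d" for r
  proof -
    have "odd r \<or> odd (d - r)" using assms that by auto
    then show ?thesis using bessel_fps_nth_odd by (metis mult_zero_left mult_zero_right)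
  qed
  then show ?thesis unfolding burnside_eigenvalue_fps fps_mult_nth by (simp add: sum.neutral)
qed

text \<open>
  The Cauchy product of the even series \<open>g\<close> with itself is, up to the factor
  \<open>1 / (16\<^sup>k k!\<^sup>2)\<close>, the sum of the squares \<open>binom(k, m)\<^sup>2\<close>, which equals \<open>binom(2k, k)\<close>.
\<close>

lemma burnside_eigenvalue_even: "burnside_eigenvalue (2 * k) = (arcsine_weight k)\<^sup>2"
proof -
  let ?g = "fps_nth bessel_fps"
  have "fps_nth (bessel_fps * bessel_fps) (2 * k) = (\<Sum>r\<in>{0..2 * k}. ?g r * ?g (2 * k - r))"
    by (simp add: fps_mult_nth)
  also have "\<dots> = (\<Sum>r\<in>{r \<in> {0..2 * k}. even r}. ?g r * ?g (2 * k - r))"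
  proof (intro sum.mono_neutral_right ballI)
    fix r assume "r \<in> {0..2 * k} - {r \<in> {0..2 * k}. even r}"
    then have "odd r" by simp
    then have "?g r = 0" by (rule bessel_fps_nth_odd)
    then show "?g r * ?g (2 * k - r) = 0" by simp
  qed auto
  also have "\<dots> = (\<Sum>m\<le>k. ?g (2 * m) * ?g (2 * (k - m)))"
    by (intro sum.reindex_bij_witness[of _ "\<lambda>m. 2 * m" "\<lambda>r. r div 2"]) (auto simp: diff_mult_distrib2)
  also have "\<dots> = (\<Sum>m\<le>k. real ((k choose m)\<^sup>2) / (16 ^ k * (fact k)\<^sup>2))"
  proof (intro sum.cong refl)
    fix m assume "m \<in> {..k}"
    then have m: "m \<le> k" by simp
    have sixteen: "(16 :: real) ^ m * 16 ^ (k - m) = 16 ^ k" using m by (simp flip: power_add)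
    have "?g (2 * m) * ?g (2 * (k - m)) = 1 / (16 ^ k * (fact m * fact (k - m))\<^sup>2)"
      unfolding bessel_fps_nth(1) by (simp add: power_mult_distrib mult_ac flip: sixteen)
    also have "\<dots> = real ((k choose m)\<^sup>2) / (16 ^ k * (fact k)\<^sup>2)"
      using m by (simp add: binomial_fact power_divide)
    finally show "?g (2 * m) * ?g (2 * (k - m)) = real ((k choose m)\<^sup>2) / (16 ^ k * (fact k)\<^sup>2)" .
  qed
  also have "\<dots> = real ((2 * k) choose k) / (16 ^ k * (fact k)\<^sup>2)"
    by (simp only: choose_square_sum flip: sum_divide_distrib of_nat_sum)
  finally have "burnside_eigenvalue (2 * k) = fact (2 * k) / (fact k)\<^sup>2 * real ((2 * k) choose k) / 16 ^ k"
    by (simp add: burnside_eigenvalue_fps)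
  also have "fact (2 * k) / (fact k)\<^sup>2 = real ((2 * k) choose k)"
    using binomial_fact[of k "2 * k", where 'a = real] by (simp add: power2_eq_square)
  also have "real ((2 * k) choose k) * real ((2 * k) choose k) / 16 ^ k = (arcsine_weight k)\<^sup>2"
  proof -
    have "((2 :: real) ^ (2 * k))\<^sup>2 = 16 ^ k" by (simp add: power2_eq_square power_mult flip: power_mult_distrib)
    then show ?thesis by (simp add: arcsine_weight_eq_choose power_divide power2_eq_square)
  qed
  finally show ?thesis .
qed

section \<open>The Chebyshev polynomials are eigenfunctions\<close>

definition lumped_apply :: "nat \<Rightarrow> (nat \<Rightarrow> real) \<Rightarrow> nat \<Rightarrow> real" where
  "lumped_apply n f i = (\<Sum>j\<le>n. burnside_lumped n $$ (i, j) * f j)"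

lemma lumped_apply_add: "lumped_apply n (\<lambda>j. f j + g j) i = lumped_apply n f i + lumped_apply n g i"
  by (simp add: lumped_apply_def distrib_left sum.distrib)

lemma lumped_apply_cmult: "lumped_apply n (\<lambda>j. c * f j) i = c * lumped_apply n f i"
  by (simp add: lumped_apply_def sum_distrib_left mult.left_commute)

lemma lumped_apply_self_adjoint:
  "(\<Sum>i\<le>n. lumped_apply n f i * g i) = (\<Sum>i\<le>n. f i * lumped_apply n g i)"
proof -
  have "(\<Sum>i\<le>n. lumped_apply n f i * g i) = (\<Sum>i\<le>n. \<Sum>j\<le>n. burnside_lumped n $$ (i, j) * f j * g i)"
    by (simp add: lumped_apply_def sum_distrib_right)
  also have "\<dots> = (\<Sum>j\<le>n. \<Sum>i\<le>n. burnside_lumped n $$ (i, j) * f j * g i)"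
    by (rule sum.swap)
  also have "\<dots> = (\<Sum>j\<le>n. f j * lumped_apply n g j)"
    unfolding lumped_apply_def sum_distrib_left
    by (intro sum.cong refl) (simp add: burnside_lumped_sym mult_ac)
  finally show ?thesis .
qed

definition binomial_image_poly :: "nat \<Rightarrow> nat \<Rightarrow> real poly" where
  "binomial_image_poly n d = (\<Sum>r\<le>d. Polynomial.smult (arcsine_weight r * arcsine_weight (d - r))
     (binomial_poly r * reflected_binomial_poly n (d - r)))"

lemma lumped_apply_binomial_poly:
  "i \<le> n \<Longrightarrow> lumped_apply n (\<lambda>j. poly (binomial_poly d) (real j)) i = poly (binomial_image_poly n d) (real i)"
  by (simp add: lumped_apply_def burnside_lumped_binomial binomial_image_poly_def poly_sum)

lemma coeff_binomial_image_poly_above: "i > d \<Longrightarrow> coeff (binomial_image_poly n d) i = 0"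
proof -
  assume i: "i > d"
  have "degree (binomial_poly r * reflected_binomial_poly n (d - r)) < i" if "r \<le> d" for r
    using degree_mult_le[of "binomial_poly r" "reflected_binomial_poly n (d - r)"] that i by simp
  then show ?thesis by (simp add: binomial_image_poly_def coeff_sum coeff_eq_0)
qed

text \<open>
  The sign comes from the leading coefficient of \<open>binom(n - x, d - r)\<close> as a polynomial in \<open>x\<close>.
\<close>

lemma coeff_binomial_image_poly_top: "coeff (binomial_image_poly n d) d = burnside_eigenvalue d / fact d"
proof -
  have "coeff (binomial_poly r * reflected_binomial_poly n (d - r)) d
      = (- 1) ^ (d - r) / (fact r * fact (d - r))" if "r \<le> d" for r
    using coeff_mult_degree_sum[of "binomial_poly r" "reflected_binomial_poly n (d - r)"] that by simp
  then show ?thesis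
    unfolding binomial_image_poly_def burnside_eigenvalue_def coeff_sum sum_divide_distrib
    by (intro sum.cong refl) (simp add: binomial_fact)
qed

lemma lumped_apply_poly_lower:
  assumes "\<And>i. i \<ge> m \<Longrightarrow> coeff p i = 0"
  shows "\<exists>q. (\<forall>i\<ge>m. coeff q i = 0) \<and> (\<forall>i\<le>n. lumped_apply n (\<lambda>j. poly p (real j)) i = poly q (real i))"
  using assms
proof (rule graded_poly_induct[where B = binomial_poly and m = m])
  show "\<exists>q. (\<forall>i\<ge>m. coeff q i = 0) \<and> (\<forall>i\<le>n. lumped_apply n (\<lambda>j. poly 0 (real j)) i = poly q (real i))"
    by (intro exI[of _ 0]) (simp add: lumped_apply_def)
next
  fix p q
  assume "\<exists>r. (\<forall>i\<ge>m. coeff r i = 0) \<and> (\<forall>i\<le>n. lumped_apply n (\<lambda>j. poly p (real j)) i = poly r (real i))"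
    and "\<exists>r. (\<forall>i\<ge>m. coeff r i = 0) \<and> (\<forall>i\<le>n. lumped_apply n (\<lambda>j. poly q (real j)) i = poly r (real i))"
  then obtain r s where
      "\<forall>i\<ge>m. coeff r i = 0" "\<forall>i\<le>n. lumped_apply n (\<lambda>j. poly p (real j)) i = poly r (real i)"
      "\<forall>i\<ge>m. coeff s i = 0" "\<forall>i\<le>n. lumped_apply n (\<lambda>j. poly q (real j)) i = poly s (real i)" by blast
  then show "\<exists>r. (\<forall>i\<ge>m. coeff r i = 0) \<and> (\<forall>i\<le>n. lumped_apply n (\<lambda>j. poly (p + q) (real j)) i = poly r (real i))"
    by (intro exI[of _ "r + s"]) (simp add: lumped_apply_add)
next
  fix c p
  assume "\<exists>r. (\<forall>i\<ge>m. coeff r i = 0) \<and> (\<forall>i\<le>n. lumped_apply n (\<lambda>j. poly p (real j)) i = poly r (real i))"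
  then obtain r where
      "\<forall>i\<ge>m. coeff r i = 0" "\<forall>i\<le>n. lumped_apply n (\<lambda>j. poly p (real j)) i = poly r (real i)" by blast
  then show "\<exists>r. (\<forall>i\<ge>m. coeff r i = 0) \<and>
      (\<forall>i\<le>n. lumped_apply n (\<lambda>j. poly (Polynomial.smult c p) (real j)) i = poly r (real i))"
    by (intro exI[of _ "Polynomial.smult c r"]) (simp add: lumped_apply_cmult)
next
  fix k assume "k < m"
  then show "\<exists>q. (\<forall>i\<ge>m. coeff q i = 0) \<and>
      (\<forall>i\<le>n. lumped_apply n (\<lambda>j. poly (binomial_poly k) (real j)) i = poly q (real i))"
    using lumped_apply_binomial_poly coeff_binomial_image_poly_above
    by (intro exI[of _ "binomial_image_poly n k"]) auto
qed simp_all

text \<open>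
  \<open>Q\<close> acts on polynomials graded by degree as a triangular matrix with diagonal entries
  \<open>\<beta>\<^sub>d\<close>: the multiple of \<open>binom(x, d)\<close> in \<open>p\<close> yields the new top coefficient, the
  remainder stays below degree \<open>d\<close>.
\<close>

lemma lumped_apply_poly_top:
  assumes "\<And>i. i > d \<Longrightarrow> coeff p i = 0"
  shows "\<exists>q. (\<forall>i\<ge>d. coeff q i = 0) \<and> (\<forall>i\<le>n.
    lumped_apply n (\<lambda>j. poly p (real j)) i = burnside_eigenvalue d * poly p (real i) + poly q (real i))"
proof -
  define c where "c = coeff p d * fact d"
  define p' where "p' = p - Polynomial.smult c (binomial_poly d)"
  have p: "p = p' + Polynomial.smult c (binomial_poly d)" by (simp add: p'_def)
  have "coeff p' i = 0" if "i \<ge> d" for i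
    using that assms[of i] by (cases "i = d") (auto simp: p'_def c_def coeff_eq_0)
  from lumped_apply_poly_lower[of d p' n, OF this] obtain q' where
    q': "\<forall>i\<ge>d. coeff q' i = 0" "\<forall>i\<le>n. lumped_apply n (\<lambda>j. poly p' (real j)) i = poly q' (real i)" by blast
  define q where "q = q' + Polynomial.smult c (binomial_image_poly n d) - Polynomial.smult (burnside_eigenvalue d) p"
  have "coeff q i = 0" if "i \<ge> d" for i
    using that assms[of i] q'(1)
    by (cases "i = d") (auto simp: q_def c_def coeff_binomial_image_poly_top coeff_binomial_image_poly_above)
  moreover have "lumped_apply n (\<lambda>j. poly p (real j)) i = burnside_eigenvalue d * poly p (real i) + poly q (real i)"
    if "i \<le> n" for i
  proof -
    have "lumped_apply n (\<lambda>j. poly p (real j)) i = poly q' (real i) + c * poly (binomial_image_poly n d) (real i)"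
      by (subst p) (use q'(2) that in \<open>simp add: lumped_apply_add lumped_apply_cmult
        lumped_apply_binomial_poly[of i n d, simplified]\<close>)
    then show ?thesis by (simp add: q_def)
  qed
  ultimately show ?thesis by blast
qed

text \<open>
  The error \<open>q = Q T - \<beta>\<^sub>d T\<close> is a polynomial of degree below \<open>d\<close>. By self-adjointness
  its squared norm is the inner product of \<open>T\<close> with \<open>Q q - \<beta>\<^sub>d q\<close>, which has degree below \<open>d\<close> as well and
  to which \<open>T\<close> is therefore orthogonal.
\<close>

lemma lumped_apply_chebyshev:
  assumes "d \<le> n" "i \<le> n"
  shows "lumped_apply n (\<lambda>j. discrete_chebyshev n d (real j)) i
    = burnside_eigenvalue d * discrete_chebyshev n d (real i)"
proof -
  let ?T = "\<lambda>j. discrete_chebyshev n d (real j)"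
  have "\<exists>q. (\<forall>i\<ge>d. coeff q i = 0) \<and> (\<forall>i\<le>n. lumped_apply n ?T i = burnside_eigenvalue d * ?T i + poly q (real i))"
    using lumped_apply_poly_top[of d "chebyshev_poly n d" n] coeff_chebyshev_poly_above
    by (simp add: poly_chebyshev_poly[OF assms(1)])
  then obtain q where q: "\<And>i. i \<ge> d \<Longrightarrow> coeff q i = 0"
    "\<And>i. i \<le> n \<Longrightarrow> lumped_apply n ?T i = burnside_eigenvalue d * ?T i + poly q (real i)" by blast
  obtain r where r: "\<And>i. i \<ge> d \<Longrightarrow> coeff r i = 0"
    "\<And>i. i \<le> n \<Longrightarrow> lumped_apply n (\<lambda>j. poly q (real j)) i = poly r (real i)"
    using lumped_apply_poly_lower[of d q n] q(1) by blast
  have "(\<Sum>i\<le>n. (poly q (real i))\<^sup>2)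
     = (\<Sum>i\<le>n. lumped_apply n ?T i * poly q (real i)) - burnside_eigenvalue d * (\<Sum>i\<le>n. ?T i * poly q (real i))"
    unfolding sum_distrib_left sum_subtractf[symmetric]
    by (intro sum.cong refl) (simp add: q(2) power2_eq_square algebra_simps)
  also have "(\<Sum>i\<le>n. lumped_apply n ?T i * poly q (real i)) = (\<Sum>i\<le>n. ?T i * poly r (real i))"
    unfolding lumped_apply_self_adjoint by (intro sum.cong refl) (simp add: r(2))
  also have "\<dots> = 0" using assms(1) r(1) by (rule chebyshev_orthogonal)
  also have "(\<Sum>i\<le>n. ?T i * poly q (real i)) = 0" using assms(1) q(1) by (rule chebyshev_orthogonal)
  finally have "(\<Sum>i\<le>n. (poly q (real i))\<^sup>2) = 0" by simp
  then have "poly q (real i) = 0" using assms(2) by (simp add: sum_nonneg_eq_0_iff)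
  then show ?thesis using q(2)[OF assms(2)] by simp
qed

section \<open>Eigenspaces\<close>

lemma burnside_eigenvalue_altdef:
  "burnside_eigenvalue d = (if even d then (arcsine_weight (d div 2))\<^sup>2 else 0)"
  using burnside_eigenvalue_even[of "d div 2"] burnside_eigenvalue_odd[of d] by auto

lemma arcsine_weight_inj: "arcsine_weight k = arcsine_weight l \<longleftrightarrow> k = l"
proof -
  have "arcsine_weight (Suc m) < arcsine_weight m" for m
    using arcsine_weight_pos[of m] by (simp add: arcsine_weight_Suc divide_simps)
  then have "strict_mono (\<lambda>m. - arcsine_weight m)" by (simp add: strict_mono_Suc_iff)
  from strict_mono_eq[OF this, of k l] show ?thesis by simp
qed

lemma burnside_eigenvalue_eq_square_iff:
  "burnside_eigenvalue d = (arcsine_weight k)\<^sup>2 \<longleftrightarrow> d = 2 * k"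
  using arcsine_weight_pos[of k] arcsine_weight_pos[of "d div 2"]
  by (auto simp: burnside_eigenvalue_altdef power2_eq_iff_nonneg arcsine_weight_inj less_imp_le elim!: evenE)

lemma burnside_eigenvalue_eq_0_iff: "burnside_eigenvalue d = 0 \<longleftrightarrow> odd d"
  using arcsine_weight_pos[of "d div 2"] by (auto simp: burnside_eigenvalue_altdef)

lemma chebyshev_0: "discrete_chebyshev n j 0 = 1"
proof -
  have "discrete_chebyshev n j 0 = (\<Sum>l = 0..j. if l = 0 then 1 else 0)"
    unfolding discrete_chebyshev_def by (intro sum.cong refl) (auto simp: pochhammer_0_left)
  then show ?thesis by simp
qed

text \<open>
  A function that is orthogonal to the Chebyshev polynomials of degree up to \<open>n\<close> is orthogonal to all
  polynomials of degree up to \<open>n\<close>, among them the one that vanishes on \<open>{0, \<dots>, n}\<close> except at \<open>k\<close>.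
\<close>

lemma orthogonal_to_chebyshev_imp_zero:
  assumes "\<And>j. j \<le> n \<Longrightarrow> (\<Sum>i\<le>n. f i * discrete_chebyshev n j (real i)) = 0" and "k \<le> n"
  shows "f k = 0"
proof -
  have orth: "(\<Sum>i\<le>n. f i * poly p (real i)) = 0" if "\<And>i. i \<ge> Suc n \<Longrightarrow> coeff p i = 0" for p
    using that
  proof (rule graded_poly_induct[where B = "chebyshev_poly n" and m = "Suc n"])
    show "(\<Sum>i\<le>n. f i * poly (chebyshev_poly n j) (real i)) = 0" if "j < Suc n" for j
      using assms(1)[of j] that by (simp add: poly_chebyshev_poly)
    have top: "coeff (chebyshev_poly n j) j \<noteq> 0" if "j < Suc n" for j
      using that by (simp add: coeff_chebyshev_poly_top)
    show "coeff (chebyshev_poly n j) j \<noteq> 0" if "j < Suc n" for j by (rule top) fact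
    show "degree (chebyshev_poly n j) = j" if "j < Suc n" for j
      using top[OF that] coeff_chebyshev_poly_above[of j _ n]
      by (intro antisym degree_le le_degree) auto
    show "(\<Sum>i\<le>n. f i * poly (p + q) (real i)) = 0"
      if "(\<Sum>i\<le>n. f i * poly p (real i)) = 0" "(\<Sum>i\<le>n. f i * poly q (real i)) = 0" for p q
      using that by (simp add: distrib_left sum.distrib)
    show "(\<Sum>i\<le>n. f i * poly (Polynomial.smult c p) (real i)) = 0"
      if "(\<Sum>i\<le>n. f i * poly p (real i)) = 0" for c p
      using that by (simp add: mult.left_commute flip: sum_distrib_left)
  qed simp_all
  \<comment> \<open>Up to a factor, the interpolation polynomial of the indicator function of \<open>k\<close>.\<close>
  define p where "p = (\<Prod>i\<in>{..n} - {k}. [:- real i, 1:])"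
  have "degree p = n" using assms(2) by (simp add: p_def degree_prod_eq_sum_degree)
  then have "(\<Sum>i\<le>n. f i * poly p (real i)) = 0" by (intro orth) (simp add: coeff_eq_0)
  moreover have "poly p (real i) = 0" if "i \<in> {..n} - {k}" for i
    using that unfolding p_def poly_prod by (intro prod_zero) (auto intro!: bexI[of _ i])
  then have "(\<Sum>i\<le>n. f i * poly p (real i)) = f k * poly p (real k)"
    using assms(2) by (subst sum.remove[of _ k]) auto
  moreover have "poly p (real k) \<noteq> 0" by (auto simp: p_def poly_prod)
  ultimately show ?thesis by simp
qed

lemma chebyshev_orthogonal_pair:
  assumes "j \<le> n" "l \<le> n" "j \<noteq> l"
  shows "(\<Sum>i\<le>n. discrete_chebyshev n j (real i) * discrete_chebyshev n l (real i)) = 0"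
proof -
  have *: "(\<Sum>i\<le>n. discrete_chebyshev n j (real i) * discrete_chebyshev n l (real i)) = 0"
    if "l < j" "j \<le> n" for j l
    using chebyshev_orthogonal[of j n "chebyshev_poly n l"] coeff_chebyshev_poly_above that
    by (simp add: poly_chebyshev_poly)
  show ?thesis using *[of l j] *[of j l] assms by (cases j l rule: linorder_cases) (auto simp: mult.commute)
qed

lemma chebyshev_norm_pos: "(\<Sum>i\<le>n. (discrete_chebyshev n j (real i))\<^sup>2) > 0"
  by (rule sum_pos2[of _ 0]) (auto simp: chebyshev_0)

lemma scalar_prod_as_sum:
  "v \<in> carrier_vec (Suc n) \<Longrightarrow> w \<in> carrier_vec (Suc n) \<Longrightarrow> v \<bullet> w = (\<Sum>i\<le>n. v $ i * w $ i)"
  by (simp add: scalar_prod_def atLeast0LessThan lessThan_Suc_atMost)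

lemma chebyshev_vec_simps [simp]:
  "discrete_chebyshev_vec n j \<in> carrier_vec (Suc n)"
  "dim_vec (discrete_chebyshev_vec n j) = Suc n"
  "i \<le> n \<Longrightarrow> discrete_chebyshev_vec n j $ i = discrete_chebyshev n j (real i)"
  by (auto simp: discrete_chebyshev_vec_def)

lemma scalar_prod_chebyshev_vec:
  assumes "j \<le> n" "l \<le> n"
  shows "discrete_chebyshev_vec n j \<bullet> discrete_chebyshev_vec n l = 0 \<longleftrightarrow> j \<noteq> l"
proof -
  have "discrete_chebyshev_vec n j \<bullet> discrete_chebyshev_vec n l
      = (\<Sum>i\<le>n. discrete_chebyshev n j (real i) * discrete_chebyshev n l (real i))"
    by (simp add: scalar_prod_as_sum[of _ n])
  then show ?thesis
    using chebyshev_orthogonal_pair[OF assms] chebyshev_norm_pos[of n j]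
    by (auto simp: power2_eq_square)
qed

lemma inj_on_chebyshev_vec: "inj_on (discrete_chebyshev_vec n) {..n}"
  by (rule inj_onI) (metis atMost_iff scalar_prod_chebyshev_vec)

lemma dim_burnside_lumped [simp]: "dim_row (burnside_lumped n) = Suc n" "dim_col (burnside_lumped n) = Suc n"
  by (simp_all add: burnside_lumped_def)

lemma burnside_lumped_mult_vec:
  assumes "v \<in> carrier_vec (Suc n)" "i \<le> n"
  shows "(burnside_lumped n *\<^sub>v v) $ i = lumped_apply n (\<lambda>j. v $ j) i"
  using assms by (simp add: lumped_apply_def scalar_prod_def atLeast0LessThan lessThan_Suc_atMost)

lemma burnside_lumped_chebyshev_vec:
  assumes "j \<le> n"
  shows "burnside_lumped n *\<^sub>v discrete_chebyshev_vec n j = burnside_eigenvalue j \<cdot>\<^sub>v discrete_chebyshev_vec n j"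
proof (rule eq_vecI)
  fix i assume "i < dim_vec (burnside_eigenvalue j \<cdot>\<^sub>v discrete_chebyshev_vec n j)"
  then have i: "i \<le> n" by simp
  have "lumped_apply n (\<lambda>l. discrete_chebyshev_vec n j $ l) i = lumped_apply n (\<lambda>l. discrete_chebyshev n j (real l)) i"
    by (simp add: lumped_apply_def)
  then show "(burnside_lumped n *\<^sub>v discrete_chebyshev_vec n j) $ i
     = (burnside_eigenvalue j \<cdot>\<^sub>v discrete_chebyshev_vec n j) $ i"
    using i by (simp add: burnside_lumped_mult_vec lumped_apply_chebyshev[OF assms] del: index_mult_mat_vec)
qed simp

lemma eigenspace_orthogonal:
  assumes v: "v \<in> eigenspace (burnside_lumped n) \<beta>" and j: "j \<le> n" "burnside_eigenvalue j \<noteq> \<beta>"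
  shows "v \<bullet> discrete_chebyshev_vec n j = 0"
proof -
  have vc: "v \<in> carrier_vec (Suc n)" and ev: "burnside_lumped n *\<^sub>v v = \<beta> \<cdot>\<^sub>v v"
    using v by (auto simp: eigenspace_def)
  have Qv: "lumped_apply n (\<lambda>j. v $ j) i = \<beta> * v $ i" if "i \<le> n" for i
    using burnside_lumped_mult_vec[OF vc that] vc that by (simp add: ev)
  let ?T = "\<lambda>i. discrete_chebyshev n j (real i)"
  have "\<beta> * (\<Sum>i\<le>n. v $ i * ?T i) = (\<Sum>i\<le>n. lumped_apply n (\<lambda>j. v $ j) i * ?T i)"
    by (simp add: Qv sum_distrib_left mult.assoc)
  also have "\<dots> = burnside_eigenvalue j * (\<Sum>i\<le>n. v $ i * ?T i)"
    unfolding lumped_apply_self_adjoint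
    by (simp add: lumped_apply_chebyshev[OF j(1)] sum_distrib_left mult.left_commute)
  finally have "(\<Sum>i\<le>n. v $ i * ?T i) = 0" using j(2) by simp
  then show ?thesis by (simp add: scalar_prod_as_sum[OF vc])
qed

text \<open>
  Independence is orthogonality. For the span, an eigenvector minus its orthogonal projection to the
  span of the \<open>T\<^sub>j\<close> with eigenvalue \<open>\<beta>\<close> is orthogonal to these by construction and to the other \<open>T\<^sub>j\<close>
  because they belong to other eigenvalues, hence it is zero. The statement covers every real
  \<open>\<beta>\<close>, with an empty basis if no \<open>T\<^sub>j\<close> has it as its eigenvalue.
\<close>

lemma eigenbasis_chebyshev:
  "eigenbasis (burnside_lumped n) \<beta> {j. j \<le> n \<and> burnside_eigenvalue j = \<beta>} (discrete_chebyshev_vec n)"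
proof -
  interpret vec_space "TYPE(real)" "Suc n" .
  let ?T = "discrete_chebyshev_vec n"
  define I where "I = {j. j \<le> n \<and> burnside_eigenvalue j = \<beta>}"
  have fin: "finite (?T ` I)" and carrier: "?T ` I \<subseteq> carrier_vec (Suc n)" by (auto simp: I_def)
  have inj: "inj_on ?T I"
    by (rule inj_on_subset[OF inj_on_chebyshev_vec]) (auto simp: I_def)
  have coord: "lincomb a (?T ` I) \<bullet> ?T j = (if j \<in> I then a (?T j) * (?T j \<bullet> ?T j) else 0)" if "j \<le> n" for a j
  proof -
    have "lincomb a (?T ` I) \<bullet> ?T j = (\<Sum>l\<in>I. (a (?T l) \<cdot>\<^sub>v ?T l) \<bullet> ?T j)"
      unfolding lincomb_def using carrier
      by (subst finsum_scalar_prod_sum) (auto simp: sum.reindex[OF inj])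
    also have "\<dots> = (\<Sum>l\<in>I. if l = j then a (?T j) * (?T j \<bullet> ?T j) else 0)"
      using that by (intro sum.cong refl) (auto simp: I_def scalar_prod_chebyshev_vec)
    finally show ?thesis by (simp add: I_def)
  qed
  have ev: "eigenvector (burnside_lumped n) (?T j) \<beta>" if "j \<in> I" for j
  proof -
    have "?T j \<noteq> 0\<^sub>v (Suc n)" using scalar_prod_chebyshev_vec[of j n j] that by (auto simp: I_def)
    then show ?thesis using that by (auto simp: eigenvector_def I_def burnside_lumped_chebyshev_vec)
  qed
  have indpt: "lin_indpt (?T ` I)"
  proof (rule finite_lin_indpt2[OF fin])
    show "?T ` I \<subseteq> carrier_vec (Suc n)" by (rule carrier)
    fix a assume "lincomb a (?T ` I) = 0\<^sub>v (Suc n)"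
    then show "\<forall>v\<in>?T ` I. a v = 0"
      using coord[of _ a] scalar_prod_chebyshev_vec by (fastforce simp: I_def)
  qed
  have "span (?T ` I) = eigenspace (burnside_lumped n) \<beta>"
  proof (intro equalityI subsetI)
    fix v assume "v \<in> span (?T ` I)"
    then obtain a where v: "v = lincomb a (?T ` I)" using finite_in_span[OF fin carrier] by auto
    have vc: "v \<in> carrier_vec (Suc n)" unfolding v using carrier by (intro lincomb_closed) auto
    have vi: "v $ i = (\<Sum>l\<in>I. a (?T l) * ?T l $ i)" if "i \<le> n" for i
      unfolding v using that by (subst lincomb_index[OF _ carrier]) (auto simp: sum.reindex[OF inj])
    have "burnside_lumped n *\<^sub>v v = \<beta> \<cdot>\<^sub>v v"
    proof (rule eq_vecI)
      fix i assume "i < dim_vec (\<beta> \<cdot>\<^sub>v v)"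
      then have i: "i \<le> n" using vc by simp
      have "(burnside_lumped n *\<^sub>v v) $ i = (\<Sum>l\<in>I. a (?T l) * lumped_apply n (\<lambda>k. ?T l $ k) i)"
        unfolding burnside_lumped_mult_vec[OF vc i] lumped_apply_def
        by (simp add: vi sum_distrib_left mult.left_commute, subst sum.swap, rule refl)
      also have "\<dots> = (\<Sum>l\<in>I. a (?T l) * (\<beta> * ?T l $ i))"
      proof (intro sum.cong refl)
        fix l assume l: "l \<in> I"
        then have "burnside_lumped n *\<^sub>v ?T l = \<beta> \<cdot>\<^sub>v ?T l"
          by (simp add: I_def burnside_lumped_chebyshev_vec)
        then show "a (?T l) * lumped_apply n (\<lambda>k. ?T l $ k) i = a (?T l) * (\<beta> * ?T l $ i)"
          using i burnside_lumped_mult_vec[of "?T l" n i] by simp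
      qed
      also have "\<dots> = (\<beta> \<cdot>\<^sub>v v) $ i"
        using i vc by (simp add: vi sum_distrib_left mult.left_commute)
      finally show "(burnside_lumped n *\<^sub>v v) $ i = (\<beta> \<cdot>\<^sub>v v) $ i" .
    qed (use vc in simp)
    then show "v \<in> eigenspace (burnside_lumped n) \<beta>" using vc by (simp add: eigenspace_def)
  next
    fix v assume v: "v \<in> eigenspace (burnside_lumped n) \<beta>"
    then have vc: "v \<in> carrier_vec (Suc n)" by (simp add: eigenspace_def)
    \<comment> \<open>The coefficients of the orthogonal projection of \<open>v\<close>.\<close>
    define a where "a = (\<lambda>w. (v \<bullet> w) / (w \<bullet> w))"
    define u where "u = lincomb a (?T ` I)"
    have uc: "u \<in> carrier_vec (Suc n)" unfolding u_def using carrier by (intro lincomb_closed) auto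
    have "(v - u) \<bullet> ?T j = 0" if "j \<le> n" for j
    proof -
      have "(v - u) \<bullet> ?T j = v \<bullet> ?T j - u \<bullet> ?T j"
        using vc uc by (intro minus_scalar_prod_distrib[of _ "Suc n"]) auto
      also have "\<dots> = 0"
        unfolding u_def coord[OF that]
        using that eigenspace_orthogonal[OF v that] scalar_prod_chebyshev_vec[OF that that]
        by (auto simp: a_def I_def)
      finally show ?thesis .
    qed
    then have "(v - u) $ k = 0" if "k \<le> n" for k
      using orthogonal_to_chebyshev_imp_zero[of n "\<lambda>i. (v - u) $ i" k] that vc uc
      by (simp add: scalar_prod_as_sum[of _ n])
    then have "v = u" using vc uc by (intro eq_vecI) auto
    then show "v \<in> span (?T ` I)" using fin unfolding u_def by blast
  qed
  then show ?thesis using ev inj indpt by (simp add: eigenbasis_def flip: I_def)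
qed

lemma eigenvalue_burnside_lumped_iff:
  "eigenvalue (burnside_lumped n) \<beta> \<longleftrightarrow> (\<exists>j\<le>n. burnside_eigenvalue j = \<beta>)"
proof
  assume "eigenvalue (burnside_lumped n) \<beta>"
  then obtain v where v: "eigenvector (burnside_lumped n) v \<beta>" by (auto simp: eigenvalue_def)
  show "\<exists>j\<le>n. burnside_eigenvalue j = \<beta>"
  proof (rule ccontr)
    assume contra: "\<not> ?thesis"
    have vc: "v \<in> carrier_vec (Suc n)" and "v \<in> eigenspace (burnside_lumped n) \<beta>"
      using v by (auto simp: eigenvector_def eigenspace_def)
    then have "v \<bullet> discrete_chebyshev_vec n j = 0" if "j \<le> n" for j
      using eigenspace_orthogonal contra that by blast
    then have "v $ k = 0" if "k \<le> n" for k
      using orthogonal_to_chebyshev_imp_zero[of n "\<lambda>i. v $ i" k] that vc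
      by (simp add: scalar_prod_as_sum[of _ n])
    then have "v = 0\<^sub>v (Suc n)" using vc by (intro eq_vecI) auto
    then show False using v by (simp add: eigenvector_def)
  qed
next
  assume "\<exists>j\<le>n. burnside_eigenvalue j = \<beta>"
  then show "eigenvalue (burnside_lumped n) \<beta>"
    using eigenbasis_chebyshev[of n \<beta>] by (auto simp: eigenbasis_def eigenvalue_def)
qed

theorem theorem1p2:
  fixes n :: nat
  assumes "n \<ge> 1"
  shows "{\<beta>. eigenvalue (burnside_lumped n) \<beta> \<and> \<beta> \<noteq> 0} =
           {1} \<union> {(real ((2 * k) choose k))\<^sup>2 / 2 ^ (4 * k) | k. 1 \<le> k \<and> k \<le> n div 2} \<and>
         eigenbasis (burnside_lumped n) 0 {j. j \<le> n \<and> odd j} (discrete_chebyshev_vec n) \<and>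
         (\<forall>k. 1 \<le> k \<and> k \<le> n div 2 \<longrightarrow>
            eigenbasis (burnside_lumped n) ((real ((2 * k) choose k))\<^sup>2 / 2 ^ (4 * k))
              {2 * k} (discrete_chebyshev_vec n))"
proof (intro conjI allI impI)
  have square: "(real ((2 * k) choose k))\<^sup>2 / 2 ^ (4 * k) = (arcsine_weight k)\<^sup>2" for k
    by (simp add: arcsine_weight_eq_choose power_divide flip: power_mult)
  have "{\<beta>. eigenvalue (burnside_lumped n) \<beta> \<and> \<beta> \<noteq> 0} = {(arcsine_weight k)\<^sup>2 | k. k \<le> n div 2}"
  proof (intro equalityI subsetI)
    fix \<beta> assume "\<beta> \<in> {\<beta>. eigenvalue (burnside_lumped n) \<beta> \<and> \<beta> \<noteq> 0}"
    then obtain j where "j \<le> n" "burnside_eigenvalue j = \<beta>" "even j"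
      by (auto simp: eigenvalue_burnside_lumped_iff burnside_eigenvalue_eq_0_iff)
    then show "\<beta> \<in> {(arcsine_weight k)\<^sup>2 | k. k \<le> n div 2}"
      by (auto simp: burnside_eigenvalue_altdef intro!: exI[of _ "j div 2"] div_le_mono)
  next
    fix \<beta> assume "\<beta> \<in> {(arcsine_weight k)\<^sup>2 | k. k \<le> n div 2}"
    then obtain k where "k \<le> n div 2" "\<beta> = (arcsine_weight k)\<^sup>2" by blast
    then show "\<beta> \<in> {\<beta>. eigenvalue (burnside_lumped n) \<beta> \<and> \<beta> \<noteq> 0}"
      using arcsine_weight_pos[of k]
      by (auto simp: eigenvalue_burnside_lumped_iff burnside_eigenvalue_even intro!: exI[of _ "2 * k"])
  qed
  also have "\<dots> = {1} \<union> {(arcsine_weight k)\<^sup>2 | k. 1 \<le> k \<and> k \<le> n div 2}"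
  proof -
    have "{k. k \<le> n div 2} = {0} \<union> {k. 1 \<le> k \<and> k \<le> n div 2}" by auto
    then show ?thesis unfolding setcompr_eq_image by simp
  qed
  finally show "{\<beta>. eigenvalue (burnside_lumped n) \<beta> \<and> \<beta> \<noteq> 0} =
      {1} \<union> {(real ((2 * k) choose k))\<^sup>2 / 2 ^ (4 * k) | k. 1 \<le> k \<and> k \<le> n div 2}"
    by (simp only: square)
  show "eigenbasis (burnside_lumped n) 0 {j. j \<le> n \<and> odd j} (discrete_chebyshev_vec n)"
    using eigenbasis_chebyshev[of n 0] by (simp only: burnside_eigenvalue_eq_0_iff)
  fix k assume "1 \<le> k \<and> k \<le> n div 2"
  then have "{j. j \<le> n \<and> j = 2 * k} = {2 * k}" by auto
  then show "eigenbasis (burnside_lumped n) ((real ((2 * k) choose k))\<^sup>2 / 2 ^ (4 * k))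
      {2 * k} (discrete_chebyshev_vec n)"
    using eigenbasis_chebyshev[of n "(arcsine_weight k)\<^sup>2"]
    by (simp only: square burnside_eigenvalue_eq_square_iff)
qed

end
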